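(* The category $\mathsf{CDeVe}$ of compact de Vries extensions is equivalent to the category $\mathsf{DeV}$ of de Vries algebras and de Vries morphisms.
   Context: A de Vries algebra is a pair $\mathfrak A=(A,\prec)$, where $A$ is a complete Boolean algebra and $\prec$ is a binary relation on $A$ with: (DV1) $1\prec 1$; (DV2) $a\prec b$ implies $a\le b$; (DV3) $a\le b\prec c\le d$ implies $a\prec d$; (DV4) $a\prec b,c$ implies $a\prec b\wedge c$; (DV5) $a\prec b$ implies $\neg b\prec\neg a$; (DV6) $a\prec b$ implies there is $c$ with $a\prec c\prec b$; (DV7) $b=\bigvee\{a\in A\mid a\prec b\}$. A de Vries morphism $\rho:\mathfrak A\to\mathfrak B$ is a map with: (M1) $\rho(0)=0$; (M2) $\rho(a\wedge b)=\rho(a)\wedge\rho(b)$; (M3) $a\prec b$ implies $\neg\rho(\neg a)\prec\rho(b)$; (M4) $\rho(b)=\bigvee\{\rho(a)\mid a\prec b\}$. De Vries algebras and de Vries morphisms form the category $\mathsf{DeV}$, with composition of $\rho_1:\mathfrak A_1\to\mathfrak A_2$ and $\rho_2:\mathfrak A_2\to\mathfrak A_3$ given by $(\rho_2\star\rho_1)(b)=\bigvee\{\rho_2(\rho_1(a))\mid a\prec b\}$. A de Vries algebra is extremally disconnected if $a\prec b$ iff $a\le b$, and atomic if $A$ is an atomic Boolean algebra. A de Vries extension is a one-to-one de Vries morphism $\alpha:\mathfrak A\to\mathfrak B$ with $\mathfrak B$ atomic and extremally disconnected such that every element of $\mathfrak B$ is a join of meets of elements of $\alpha[\mathfrak A]$.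 The category $\mathsf{DeVe}$ has as objects de Vries extensions; a morphism from $\alpha:\mathfrak A\to\mathfrak B$ to $\alpha':\mathfrak A'\to\mathfrak B'$ is a pair $(\rho,\sigma)$ with $\rho:\mathfrak A\to\mathfrak A'$ a de Vries morphism and $\sigma:\mathfrak B\to\mathfrak B'$ a complete Boolean homomorphism such that $\sigma\circ\alpha=\alpha'\star\rho$. Composition is $(\rho_2,\sigma_2)(\rho_1,\sigma_1)=(\rho_2\star\rho_1,\sigma_2\circ\sigma_1)$. A filter $F$ of $\mathfrak A$ is round if for each $b\in F$ there is $a\in F$ with $a\prec b$; an ideal $I$ is round if for each $a\in I$ there is $b\in I$ with $a\prec b$. A de Vries extension $\alpha:\mathfrak A\to\mathfrak B$ is compact if: whenever $F$ is a round filter and $I$ a round ideal of $\mathfrak A$ with $\bigwedge\alpha[F]\le\bigvee\alpha[I]$, then $F\cap I\ne\varnothing$. $\mathsf{CDeVe}$ is the full subcategory of $\mathsf{DeVe}$ consisting of compact de Vries extensions. *)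

theory Defs
  imports "HOL-Algebra.Complete_Lattice" "HOL-Library.FuncSet"
begin

section \<open>Categories and equivalence of categories\<close>

text \<open>
  A category is given by its objects and a family of hom-sets. Hom-sets need not be disjoint,
  so composition takes the three objects involved as arguments: \<open>Comp C X Y Z g f\<close> is the
  composite of \<open>f : X \<rightarrow> Y\<close> and \<open>g : Y \<rightarrow> Z\<close>.
\<close>

record ('o, 'm) category =
  Obj :: "'o set"
  Hom :: "'o \<Rightarrow> 'o \<Rightarrow> 'm set"
  Id :: "'o \<Rightarrow> 'm"
  Comp :: "'o \<Rightarrow> 'o \<Rightarrow> 'o \<Rightarrow> 'm \<Rightarrow> 'm \<Rightarrow> 'm"

definition is_category :: "('o, 'm) category \<Rightarrow> bool" where
  "is_category C \<longleftrightarrow>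
     (\<forall>X\<in>Obj C. Id C X \<in> Hom C X X) \<and>
     (\<forall>X\<in>Obj C. \<forall>Y\<in>Obj C. \<forall>Z\<in>Obj C. \<forall>f\<in>Hom C X Y. \<forall>g\<in>Hom C Y Z.
        Comp C X Y Z g f \<in> Hom C X Z) \<and>
     (\<forall>X\<in>Obj C. \<forall>Y\<in>Obj C. \<forall>f\<in>Hom C X Y.
        Comp C X X Y f (Id C X) = f \<and> Comp C X Y Y (Id C Y) f = f) \<and>
     (\<forall>W\<in>Obj C. \<forall>X\<in>Obj C. \<forall>Y\<in>Obj C. \<forall>Z\<in>Obj C.
        \<forall>f\<in>Hom C W X. \<forall>g\<in>Hom C X Y. \<forall>h\<in>Hom C Y Z.
          Comp C W X Z (Comp C X Y Z h g) f = Comp C W Y Z h (Comp C W X Y g f))"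

definition full_subcategory :: "('o, 'm) category \<Rightarrow> ('o \<Rightarrow> bool) \<Rightarrow> ('o, 'm) category" where
  "full_subcategory C P = C\<lparr>Obj := {X \<in> Obj C. P X}\<rparr>"

definition is_iso :: "('o, 'm) category \<Rightarrow> 'o \<Rightarrow> 'o \<Rightarrow> 'm \<Rightarrow> bool" where
  "is_iso C X Y f \<longleftrightarrow> f \<in> Hom C X Y \<and>
     (\<exists>g\<in>Hom C Y X. Comp C X Y X g f = Id C X \<and> Comp C Y X Y f g = Id C Y)"

record ('o, 'm, 'p, 'n) cfunctor =
  omap :: "'o \<Rightarrow> 'p"
  amap :: "'o \<Rightarrow> 'o \<Rightarrow> 'm \<Rightarrow> 'n"

definition is_functor ::
  "('o, 'm) category \<Rightarrow> ('p, 'n) category \<Rightarrow> ('o, 'm, 'p, 'n) cfunctor \<Rightarrow> bool" where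
  "is_functor C D F \<longleftrightarrow>
     (\<forall>X\<in>Obj C. omap F X \<in> Obj D) \<and>
     (\<forall>X\<in>Obj C. \<forall>Y\<in>Obj C. \<forall>f\<in>Hom C X Y. amap F X Y f \<in> Hom D (omap F X) (omap F Y)) \<and>
     (\<forall>X\<in>Obj C. amap F X X (Id C X) = Id D (omap F X)) \<and>
     (\<forall>X\<in>Obj C. \<forall>Y\<in>Obj C. \<forall>Z\<in>Obj C. \<forall>f\<in>Hom C X Y. \<forall>g\<in>Hom C Y Z.
        amap F X Z (Comp C X Y Z g f) =
          Comp D (omap F X) (omap F Y) (omap F Z) (amap F Y Z g) (amap F X Y f))"

definition id_functor :: "('o, 'm, 'o, 'm) cfunctor" where
  "id_functor = \<lparr>omap = (\<lambda>X. X), amap = (\<lambda>X Y f. f)\<rparr>"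

definition comp_functor ::
  "('p, 'n, 'q, 'k) cfunctor \<Rightarrow> ('o, 'm, 'p, 'n) cfunctor \<Rightarrow> ('o, 'm, 'q, 'k) cfunctor" where
  "comp_functor G F =
     \<lparr>omap = (\<lambda>X. omap G (omap F X)),
      amap = (\<lambda>X Y f. amap G (omap F X) (omap F Y) (amap F X Y f))\<rparr>"

definition natural_iso ::
  "('o, 'm) category \<Rightarrow> ('p, 'n) category \<Rightarrow> ('o, 'm, 'p, 'n) cfunctor \<Rightarrow>
   ('o, 'm, 'p, 'n) cfunctor \<Rightarrow> ('o \<Rightarrow> 'n) \<Rightarrow> bool" where
  "natural_iso C D F G \<eta> \<longleftrightarrow>
     (\<forall>X\<in>Obj C. is_iso D (omap F X) (omap G X) (\<eta> X)) \<and>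
     (\<forall>X\<in>Obj C. \<forall>Y\<in>Obj C. \<forall>f\<in>Hom C X Y.
        Comp D (omap F X) (omap F Y) (omap G Y) (\<eta> Y) (amap F X Y f) =
        Comp D (omap F X) (omap G X) (omap G Y) (amap G X Y f) (\<eta> X))"

definition equivalent_categories ::
  "('o, 'm) category \<Rightarrow> ('p, 'n) category \<Rightarrow> bool" where
  "equivalent_categories C D \<longleftrightarrow> is_category C \<and> is_category D \<and>
     (\<exists>F G. is_functor C D F \<and> is_functor D C G \<and>
        (\<exists>\<eta>. natural_iso C C id_functor (comp_functor G F) \<eta>) \<and>
        (\<exists>\<epsilon>. natural_iso D D (comp_functor F G) id_functor \<epsilon>))"

section \<open>Complete Boolean algebras\<close>

definition complement :: "('a, 'b) gorder_scheme \<Rightarrow> 'a \<Rightarrow> 'a" (\<open>\<sim>\<index> _\<close> [81] 80) where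
  "\<sim>\<^bsub>L\<^esub> x = (THE y. y \<in> carrier L \<and> x \<sqinter>\<^bsub>L\<^esub> y = \<bottom>\<^bsub>L\<^esub> \<and> x \<squnion>\<^bsub>L\<^esub> y = \<top>\<^bsub>L\<^esub>)"

locale complete_boolean_lattice = complete_lattice L for L (structure) +
  assumes distrib:
      "\<lbrakk>x \<in> carrier L; y \<in> carrier L; z \<in> carrier L\<rbrakk>
        \<Longrightarrow> x \<sqinter> (y \<squnion> z) = (x \<sqinter> y) \<squnion> (x \<sqinter> z)"
    and complemented:
      "x \<in> carrier L \<Longrightarrow> \<exists>y\<in>carrier L. x \<sqinter> y = \<bottom> \<and> x \<squnion> y = \<top>"

definition atom :: "('a, 'b) gorder_scheme \<Rightarrow> 'a \<Rightarrow> bool" where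
  "atom L a \<longleftrightarrow> a \<in> carrier L \<and> a \<noteq> \<bottom>\<^bsub>L\<^esub> \<and>
     (\<forall>x\<in>carrier L. x \<sqsubseteq>\<^bsub>L\<^esub> a \<longrightarrow> x = \<bottom>\<^bsub>L\<^esub> \<or> x = a)"

definition atomic :: "('a, 'b) gorder_scheme \<Rightarrow> bool" where
  "atomic L \<longleftrightarrow> (\<forall>x\<in>carrier L. x \<noteq> \<bottom>\<^bsub>L\<^esub> \<longrightarrow> (\<exists>a. atom L a \<and> a \<sqsubseteq>\<^bsub>L\<^esub> x))"

text \<open>
  All structure-preserving maps below are extensional (\<open>undefined\<close> off the carrier), so that
  equality in HOL is equality of maps on the carrier.
\<close>

definition complete_boolean_hom ::
  "('a, 'c) gorder_scheme \<Rightarrow> ('b, 'd) gorder_scheme \<Rightarrow> ('a \<Rightarrow> 'b) \<Rightarrow> bool" where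
  "complete_boolean_hom A B \<sigma> \<longleftrightarrow>
     \<sigma> \<in> carrier A \<rightarrow>\<^sub>E carrier B \<and>
     (\<forall>S\<subseteq>carrier A. \<sigma> (\<Squnion>\<^bsub>A\<^esub> S) = \<Squnion>\<^bsub>B\<^esub> (\<sigma> ` S)) \<and>
     (\<forall>S\<subseteq>carrier A. \<sigma> (\<Sqinter>\<^bsub>A\<^esub> S) = \<Sqinter>\<^bsub>B\<^esub> (\<sigma> ` S)) \<and>
     (\<forall>a\<in>carrier A. \<sigma> (\<sim>\<^bsub>A\<^esub> a) = \<sim>\<^bsub>B\<^esub> (\<sigma> a))"

section \<open>De Vries algebras\<close>

record 'a devries = "'a gorder" +
  prox :: "'a \<Rightarrow> 'a \<Rightarrow> bool" (infixl \<open>\<prec>\<index>\<close> 50)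

locale de_vries_algebra = complete_boolean_lattice L for L (structure) +
  assumes DV1: "\<top> \<prec> \<top>"
    and DV2: "\<lbrakk>a \<in> carrier L; b \<in> carrier L; a \<prec> b\<rbrakk> \<Longrightarrow> a \<sqsubseteq> b"
    and DV3: "\<lbrakk>a \<in> carrier L; b \<in> carrier L; c \<in> carrier L; d \<in> carrier L;
               a \<sqsubseteq> b; b \<prec> c; c \<sqsubseteq> d\<rbrakk> \<Longrightarrow> a \<prec> d"
    and DV4: "\<lbrakk>a \<in> carrier L; b \<in> carrier L; c \<in> carrier L; a \<prec> b; a \<prec> c\<rbrakk> \<Longrightarrow> a \<prec> b \<sqinter> c"
    and DV5: "\<lbrakk>a \<in> carrier L; b \<in> carrier L; a \<prec> b\<rbrakk> \<Longrightarrow> \<sim> b \<prec> \<sim> a"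
    and DV6: "\<lbrakk>a \<in> carrier L; b \<in> carrier L; a \<prec> b\<rbrakk> \<Longrightarrow> \<exists>c\<in>carrier L. a \<prec> c \<and> c \<prec> b"
    and DV7: "b \<in> carrier L \<Longrightarrow> b = \<Squnion> {a \<in> carrier L. a \<prec> b}"

definition de_vries_morphism :: "'a devries \<Rightarrow> 'b devries \<Rightarrow> ('a \<Rightarrow> 'b) \<Rightarrow> bool" where
  "de_vries_morphism A B \<rho> \<longleftrightarrow>
     \<rho> \<in> carrier A \<rightarrow>\<^sub>E carrier B \<and>
     \<rho> \<bottom>\<^bsub>A\<^esub> = \<bottom>\<^bsub>B\<^esub> \<and>
     (\<forall>a\<in>carrier A. \<forall>b\<in>carrier A. \<rho> (a \<sqinter>\<^bsub>A\<^esub> b) = \<rho> a \<sqinter>\<^bsub>B\<^esub> \<rho> b) \<and>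
     (\<forall>a\<in>carrier A. \<forall>b\<in>carrier A. a \<prec>\<^bsub>A\<^esub> b \<longrightarrow> \<sim>\<^bsub>B\<^esub> \<rho> (\<sim>\<^bsub>A\<^esub> a) \<prec>\<^bsub>B\<^esub> \<rho> b) \<and>
     (\<forall>b\<in>carrier A. \<rho> b = \<Squnion>\<^bsub>B\<^esub> (\<rho> ` {a \<in> carrier A. a \<prec>\<^bsub>A\<^esub> b}))"

text \<open>
  \<open>dv_comp A1 A3 \<rho>2 \<rho>1\<close> is the composite \<open>\<rho>2 \<star> \<rho>1\<close> of \<open>\<rho>1 : A1 \<rightarrow> A2\<close> and \<open>\<rho>2 : A2 \<rightarrow> A3\<close>.
\<close>

definition dv_comp ::
  "'a devries \<Rightarrow> 'c devries \<Rightarrow> ('b \<Rightarrow> 'c) \<Rightarrow> ('a \<Rightarrow> 'b) \<Rightarrow> 'a \<Rightarrow> 'c" where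
  "dv_comp A1 A3 \<rho>2 \<rho>1 =
     (\<lambda>b\<in>carrier A1. \<Squnion>\<^bsub>A3\<^esub> ((\<lambda>a. \<rho>2 (\<rho>1 a)) ` {a \<in> carrier A1. a \<prec>\<^bsub>A1\<^esub> b}))"

definition DeV :: "('a devries, 'a \<Rightarrow> 'a) category" where
  "DeV =
     \<lparr>Obj = {A. de_vries_algebra A},
      Hom = (\<lambda>A B. {\<rho>. de_vries_morphism A B \<rho>}),
      Id = (\<lambda>A. \<lambda>a\<in>carrier A. a),
      Comp = (\<lambda>A1 A2 A3 \<rho>2 \<rho>1. dv_comp A1 A3 \<rho>2 \<rho>1)\<rparr>"

definition extremally_disconnected :: "'a devries \<Rightarrow> bool" where
  "extremally_disconnected A \<longleftrightarrow>
     (\<forall>a\<in>carrier A. \<forall>b\<in>carrier A. a \<prec>\<^bsub>A\<^esub> b \<longleftrightarrow> a \<sqsubseteq>\<^bsub>A\<^esub> b)"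

section \<open>De Vries extensions\<close>

record ('a, 'b) dv_ext =
  src :: "'a devries"
  tgt :: "'b devries"
  emb :: "'a \<Rightarrow> 'b"

definition de_vries_extension :: "('a, 'b) dv_ext \<Rightarrow> bool" where
  "de_vries_extension E \<longleftrightarrow>
     de_vries_algebra (src E) \<and> de_vries_algebra (tgt E) \<and>
     de_vries_morphism (src E) (tgt E) (emb E) \<and>
     inj_on (emb E) (carrier (src E)) \<and>
     atomic (tgt E) \<and> extremally_disconnected (tgt E) \<and>
     (\<forall>b\<in>carrier (tgt E). \<exists>\<S>\<subseteq>Pow (emb E ` carrier (src E)).
        b = \<Squnion>\<^bsub>tgt E\<^esub> ((\<lambda>S. \<Sqinter>\<^bsub>tgt E\<^esub> S) ` \<S>))"

definition dv_ext_morphism ::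
  "('a, 'b) dv_ext \<Rightarrow> ('c, 'd) dv_ext \<Rightarrow> ('a \<Rightarrow> 'c) \<times> ('b \<Rightarrow> 'd) \<Rightarrow> bool" where
  "dv_ext_morphism E E' = (\<lambda>(\<rho>, \<sigma>).
     de_vries_morphism (src E) (src E') \<rho> \<and>
     complete_boolean_hom (tgt E) (tgt E') \<sigma> \<and>
     compose (carrier (src E)) \<sigma> (emb E) = dv_comp (src E) (tgt E') (emb E') \<rho>)"

definition DeVe :: "(('a, 'b) dv_ext, ('a \<Rightarrow> 'a) \<times> ('b \<Rightarrow> 'b)) category" where
  "DeVe =
     \<lparr>Obj = {E. de_vries_extension E},
      Hom = (\<lambda>E E'. {f. dv_ext_morphism E E' f}),
      Id = (\<lambda>E. (\<lambda>a\<in>carrier (src E). a, \<lambda>b\<in>carrier (tgt E). b)),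
      Comp = (\<lambda>E1 E2 E3 (\<rho>2, \<sigma>2) (\<rho>1, \<sigma>1).
        (dv_comp (src E1) (src E3) \<rho>2 \<rho>1, compose (carrier (tgt E1)) \<sigma>2 \<sigma>1))\<rparr>"

text \<open>Filters and ideals are nonempty but not required to be proper.\<close>

definition lattice_filter :: "('a, 'b) gorder_scheme \<Rightarrow> 'a set \<Rightarrow> bool" where
  "lattice_filter L F \<longleftrightarrow> F \<subseteq> carrier L \<and> F \<noteq> {} \<and>
     (\<forall>a\<in>F. \<forall>b\<in>carrier L. a \<sqsubseteq>\<^bsub>L\<^esub> b \<longrightarrow> b \<in> F) \<and>
     (\<forall>a\<in>F. \<forall>b\<in>F. a \<sqinter>\<^bsub>L\<^esub> b \<in> F)"

definition lattice_ideal :: "('a, 'b) gorder_scheme \<Rightarrow> 'a set \<Rightarrow> bool" where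
  "lattice_ideal L I \<longleftrightarrow> I \<subseteq> carrier L \<and> I \<noteq> {} \<and>
     (\<forall>a\<in>I. \<forall>b\<in>carrier L. b \<sqsubseteq>\<^bsub>L\<^esub> a \<longrightarrow> b \<in> I) \<and>
     (\<forall>a\<in>I. \<forall>b\<in>I. a \<squnion>\<^bsub>L\<^esub> b \<in> I)"

definition round_filter :: "'a devries \<Rightarrow> 'a set \<Rightarrow> bool" where
  "round_filter A F \<longleftrightarrow> lattice_filter A F \<and> (\<forall>b\<in>F. \<exists>a\<in>F. a \<prec>\<^bsub>A\<^esub> b)"

definition round_ideal :: "'a devries \<Rightarrow> 'a set \<Rightarrow> bool" where
  "round_ideal A I \<longleftrightarrow> lattice_ideal A I \<and> (\<forall>a\<in>I. \<exists>b\<in>I. a \<prec>\<^bsub>A\<^esub> b)"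

definition compact_extension :: "('a, 'b) dv_ext \<Rightarrow> bool" where
  "compact_extension E \<longleftrightarrow>
     (\<forall>F I. round_filter (src E) F \<longrightarrow> round_ideal (src E) I \<longrightarrow>
        (\<Sqinter>\<^bsub>tgt E\<^esub> (emb E ` F)) \<sqsubseteq>\<^bsub>tgt E\<^esub> (\<Squnion>\<^bsub>tgt E\<^esub> (emb E ` I)) \<longrightarrow> F \<inter> I \<noteq> {})"

definition CDeVe :: "(('a, 'b) dv_ext, ('a \<Rightarrow> 'a) \<times> ('b \<Rightarrow> 'b)) category" where
  "CDeVe = full_subcategory DeVe compact_extension"

end

theory Submission
  imports Defs
begin

text \<open>
  The functor sending a compact extension \<open>\<alpha> : A \<rightarrow> B\<close> to its source \<open>A\<close> and a morphism \<open>(\<rho>, \<sigma>)\<close>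
  to \<open>\<rho>\<close> is fully faithful, and it has a section on objects; this already gives an equivalence
  (\<open>fully_faithful_section.equivalent\<close>).

  The key is the notion of an \<^emph>\<open>end\<close> of \<open>A\<close>: a maximal proper round filter, or equivalently a proper
  round filter which contains \<open>\<sim> a\<close> or \<open>b\<close> whenever \<open>a \<prec> b\<close>. In any extension an atom \<open>x\<close> of \<open>B\<close>
  determines the end \<open>{a. x \<sqsubseteq> \<alpha> a}\<close>, its trace, and the extension is compact exactly when every end is
  a trace (\<open>dv_extension.compact_iff\<close>).

  \<^item> Faithfulness: \<open>\<sigma>\<close> is determined on the elements \<open>\<alpha> a\<close>, and these generate \<open>B\<close>
    (\<open>dv_extension.hom_eqI\<close>).

  \<^item> Fullness: a de Vries morphism \<open>\<rho> : A \<rightarrow> A'\<close> pulls ends of \<open>A'\<close> back to ends of \<open>A\<close>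
    (\<open>dv_map.end_pullback\<close>). Applied to traces, this gives a map from the atoms of \<open>B'\<close> to the atoms
    of \<open>B\<close>, and its inverse image map is the required complete homomorphism \<open>B \<rightarrow> B'\<close>
    (\<open>morphism_lift\<close>).

  \<^item> Section: \<open>a \<mapsto> {F. is_end A F \<and> a \<in> F}\<close> embeds \<open>A\<close> into the powerset of its set of ends, and this is
    a compact extension (\<open>extension_by_ends\<close>). That there are enough ends is a prime filter theorem,
    proved with Zorn's lemma: disjoint round filters and round ideals are separated by an end
    (\<open>dv_algebra.end_separation\<close>). Since ends are sets of elements of \<open>A\<close>, the powerset consists of sets of
    sets, which is where the injection into the type of the target algebras enters.
\<close>

section \<open>Equivalences from a section of a fully faithful functor\<close>

lemma full_subcategory_simps:
  "Obj (full_subcategory C P) = {X \<in> Obj C. P X}"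
  "Hom (full_subcategory C P) = Hom C"
  "Id (full_subcategory C P) = Id C"
  "Comp (full_subcategory C P) = Comp C"
  by (simp_all add: full_subcategory_def)

lemma is_category_full_subcategory:
  "is_category C \<Longrightarrow> is_category (full_subcategory C P)"
  unfolding is_category_def full_subcategory_simps by (intro conjI ballI) simp_all

text \<open>A fully faithful functor \<open>F\<close> with a section \<open>K\<close> on objects is an equivalence. Because \<open>F (K A)\<close> equals
  \<open>A\<close> and is not merely isomorphic to it, \<open>K\<close> extends to a functor by lifting each morphism along \<open>F\<close>, and
  the counit is an identity. The unit at \<open>X\<close> lifts the identity of \<open>F X\<close>. All required equations are
  checked after applying \<open>F\<close>.\<close>

locale fully_faithful_section =
  fixes C :: "('o, 'm) category" and D :: "('p, 'n) category"
    and F :: "('o, 'm, 'p, 'n) cfunctor" and K :: "'p \<Rightarrow> 'o"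
  assumes cat_C: "is_category C" and cat_D: "is_category D" and func: "is_functor C D F"
    and fully_faithful: "\<lbrakk>X \<in> Obj C; Y \<in> Obj C\<rbrakk> \<Longrightarrow>
      bij_betw (amap F X Y) (Hom C X Y) (Hom D (omap F X) (omap F Y))"
    and sec_obj: "A \<in> Obj D \<Longrightarrow> K A \<in> Obj C"
    and sec: "A \<in> Obj D \<Longrightarrow> omap F (K A) = A"
begin

definition lift :: "'o \<Rightarrow> 'o \<Rightarrow> 'n \<Rightarrow> 'm" where
  "lift X Y = inv_into (Hom C X Y) (amap F X Y)"

lemma C_comp: "\<lbrakk>X \<in> Obj C; Y \<in> Obj C; Z \<in> Obj C; f \<in> Hom C X Y; g \<in> Hom C Y Z\<rbrakk>
    \<Longrightarrow> Comp C X Y Z g f \<in> Hom C X Z"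
  and C_id: "X \<in> Obj C \<Longrightarrow> Id C X \<in> Hom C X X"
  using cat_C unfolding is_category_def by blast+

lemma D_id: "A \<in> Obj D \<Longrightarrow> Id D A \<in> Hom D A A"
  and D_id_right: "\<lbrakk>A \<in> Obj D; B \<in> Obj D; f \<in> Hom D A B\<rbrakk> \<Longrightarrow> Comp D A A B f (Id D A) = f"
  and D_id_left: "\<lbrakk>A \<in> Obj D; B \<in> Obj D; f \<in> Hom D A B\<rbrakk> \<Longrightarrow> Comp D A B B (Id D B) f = f"
  and D_comp: "\<lbrakk>A \<in> Obj D; B \<in> Obj D; B' \<in> Obj D; f \<in> Hom D A B; g \<in> Hom D B B'\<rbrakk>
    \<Longrightarrow> Comp D A B B' g f \<in> Hom D A B'"
  using cat_D unfolding is_category_def by blast+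

lemma F_obj: "X \<in> Obj C \<Longrightarrow> omap F X \<in> Obj D"
  and F_hom: "\<lbrakk>X \<in> Obj C; Y \<in> Obj C; f \<in> Hom C X Y\<rbrakk>
    \<Longrightarrow> amap F X Y f \<in> Hom D (omap F X) (omap F Y)"
  and F_id: "X \<in> Obj C \<Longrightarrow> amap F X X (Id C X) = Id D (omap F X)"
  and F_comp: "\<lbrakk>X \<in> Obj C; Y \<in> Obj C; Z \<in> Obj C; f \<in> Hom C X Y; g \<in> Hom C Y Z\<rbrakk> \<Longrightarrow>
    amap F X Z (Comp C X Y Z g f) =
      Comp D (omap F X) (omap F Y) (omap F Z) (amap F Y Z g) (amap F X Y f)"
  using func unfolding is_functor_def by blast+

lemma faithful: "\<lbrakk>X \<in> Obj C; Y \<in> Obj C; f \<in> Hom C X Y; g \<in> Hom C X Y;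
    amap F X Y f = amap F X Y g\<rbrakk> \<Longrightarrow> f = g"
  using fully_faithful unfolding bij_betw_def inj_on_def by blast

lemma lift_hom: "\<lbrakk>X \<in> Obj C; Y \<in> Obj C; h \<in> Hom D (omap F X) (omap F Y)\<rbrakk> \<Longrightarrow> lift X Y h \<in> Hom C X Y"
  and F_lift: "\<lbrakk>X \<in> Obj C; Y \<in> Obj C; h \<in> Hom D (omap F X) (omap F Y)\<rbrakk>
    \<Longrightarrow> amap F X Y (lift X Y h) = h"
  using fully_faithful unfolding lift_def bij_betw_def by (metis inv_into_into, metis f_inv_into_f)

definition inverse_functor :: "('p, 'n, 'o, 'm) cfunctor" where
  "inverse_functor = \<lparr>omap = K, amap = (\<lambda>A B. lift (K A) (K B))\<rparr>"

lemma inverse_functor: "is_functor D C inverse_functor"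
  unfolding is_functor_def inverse_functor_def
proof (intro conjI ballI; simp)
  fix A assume A: "A \<in> Obj D"
  show "lift (K A) (K A) (Id D A) = Id C (K A)"
    by (rule faithful[of "K A" "K A"]) (simp_all add: A sec sec_obj lift_hom F_lift F_id C_id D_id)
next
  fix A B B' f g
  assume "A \<in> Obj D" "B \<in> Obj D" "B' \<in> Obj D" "f \<in> Hom D A B" "g \<in> Hom D B B'"
  then show "lift (K A) (K B') (Comp D A B B' g f)
      = Comp C (K A) (K B) (K B') (lift (K B) (K B') g) (lift (K A) (K B) f)"
    by (intro faithful[of "K A" "K B'"])
      (simp_all add: sec sec_obj lift_hom F_lift F_comp C_comp D_comp)
qed (simp_all add: sec sec_obj lift_hom)

lemma is_iso_lift_Id:
  assumes X: "X \<in> Obj C" and Y: "Y \<in> Obj C" and eq: "omap F X = omap F Y"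
  shows "is_iso C X Y (lift X Y (Id D (omap F X)))"
  unfolding is_iso_def
proof (intro conjI bexI)
  let ?i = "Id D (omap F X)"
  have i: "?i \<in> Hom D (omap F X) (omap F Y)" "?i \<in> Hom D (omap F Y) (omap F X)"
    using D_id[OF F_obj[OF X]] eq by simp_all
  note [simp] = X Y F_obj lift_hom[OF X Y i(1)] lift_hom[OF Y X i(2)]
    F_lift[OF X Y i(1)] F_lift[OF Y X i(2)] F_comp C_comp C_id F_id eq D_id D_id_left
  show "lift X Y ?i \<in> Hom C X Y" "lift Y X ?i \<in> Hom C Y X" by (simp_all del: eq)
  show "Comp C X Y X (lift Y X ?i) (lift X Y ?i) = Id C X"
    by (rule faithful[of X X]) (use i in \<open>simp_all add: eq[symmetric] del: eq\<close>)
  show "Comp C Y X Y (lift X Y ?i) (lift Y X ?i) = Id C Y"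
    by (rule faithful[of Y Y]) (use i in \<open>simp_all add: eq[symmetric] del: eq\<close>)
qed

theorem equivalent: "equivalent_categories C D"
proof -
  define \<eta> where "\<eta> X = lift X (K (omap F X)) (Id D (omap F X))" for X
  have "natural_iso C C id_functor (comp_functor inverse_functor F) \<eta>"
    unfolding natural_iso_def id_functor_def comp_functor_def inverse_functor_def
  proof (intro conjI ballI; simp)
    fix X assume X: "X \<in> Obj C"
    show "is_iso C X (K (omap F X)) (\<eta> X)"
      unfolding \<eta>_def using X by (intro is_iso_lift_Id) (simp_all add: sec sec_obj F_obj)
  next
    fix X Y f assume XY: "X \<in> Obj C" "Y \<in> Obj C" and f: "f \<in> Hom C X Y"
    note obj = XY F_obj[OF XY(1)] F_obj[OF XY(2)]
    have \<eta>: "\<eta> X \<in> Hom C X (K (omap F X))" "\<eta> Y \<in> Hom C Y (K (omap F Y))"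
      "amap F X (K (omap F X)) (\<eta> X) = Id D (omap F X)"
      "amap F Y (K (omap F Y)) (\<eta> Y) = Id D (omap F Y)"
      unfolding \<eta>_def using obj by (auto intro!: lift_hom F_lift simp: sec sec_obj D_id)
    show "Comp C X Y (K (omap F Y)) (\<eta> Y) f =
      Comp C X (K (omap F X)) (K (omap F Y))
        (lift (K (omap F X)) (K (omap F Y)) (amap F X Y f)) (\<eta> X)"
      by (rule faithful[of X "K (omap F Y)"])
        (simp_all add: obj f \<eta> sec sec_obj lift_hom F_lift F_comp C_comp F_hom D_id_left D_id_right)
  qed
  moreover have "natural_iso D D (comp_functor F inverse_functor) id_functor (Id D)"
    unfolding natural_iso_def id_functor_def comp_functor_def inverse_functor_def is_iso_def
    by (auto simp: sec sec_obj F_lift D_id D_id_left D_id_right intro!: bexI[of _ "Id D _"])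
  ultimately show ?thesis
    unfolding equivalent_categories_def using cat_C cat_D func inverse_functor by blast
qed

end

section \<open>Complete Boolean algebras and their atoms\<close>

context complete_lattice
begin

lemma sup_le_iff: "\<lbrakk>S \<subseteq> carrier L; z \<in> carrier L\<rbrakk> \<Longrightarrow> \<Squnion>S \<sqsubseteq> z \<longleftrightarrow> (\<forall>x\<in>S. x \<sqsubseteq> z)"
  by (meson sup_closed sup_least sup_upper le_trans subsetD)

lemma le_inf_iff: "\<lbrakk>S \<subseteq> carrier L; z \<in> carrier L\<rbrakk> \<Longrightarrow> z \<sqsubseteq> \<Sqinter>S \<longleftrightarrow> (\<forall>x\<in>S. z \<sqsubseteq> x)"
  by (meson inf_closed inf_greatest inf_lower le_trans subsetD)

lemma le_meet_iff: "\<lbrakk>x \<in> carrier L; y \<in> carrier L; z \<in> carrier L\<rbrakk>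
    \<Longrightarrow> z \<sqsubseteq> x \<sqinter> y \<longleftrightarrow> z \<sqsubseteq> x \<and> z \<sqsubseteq> y"
  by (meson le_trans meet_closed meet_le meet_left meet_right)

lemma join_le_iff: "\<lbrakk>x \<in> carrier L; y \<in> carrier L; z \<in> carrier L\<rbrakk>
    \<Longrightarrow> x \<squnion> y \<sqsubseteq> z \<longleftrightarrow> x \<sqsubseteq> z \<and> y \<sqsubseteq> z"
  by (meson le_trans join_closed join_le join_left join_right)

lemma le_bottom_iff: "x \<in> carrier L \<Longrightarrow> x \<sqsubseteq> \<bottom> \<longleftrightarrow> x = \<bottom>"
  by (auto simp: le_antisym)

lemma top_le_iff: "x \<in> carrier L \<Longrightarrow> \<top> \<sqsubseteq> x \<longleftrightarrow> x = \<top>"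
  by (auto simp: le_antisym)

lemma meet_top: "x \<in> carrier L \<Longrightarrow> x \<sqinter> \<top> = x"
  by (intro le_antisym) (simp_all add: le_meet_iff meet_left)

lemma sup_eqI: "\<lbrakk>S \<subseteq> carrier L; z \<in> carrier L; \<And>x. x \<in> S \<Longrightarrow> x \<sqsubseteq> z;
    \<And>y. \<lbrakk>y \<in> carrier L; \<And>x. x \<in> S \<Longrightarrow> x \<sqsubseteq> y\<rbrakk> \<Longrightarrow> z \<sqsubseteq> y\<rbrakk> \<Longrightarrow> \<Squnion>S = z"
  by (intro le_antisym) (simp_all add: sup_le_iff sup_upper)

lemma inf_eqI: "\<lbrakk>S \<subseteq> carrier L; z \<in> carrier L; \<And>x. x \<in> S \<Longrightarrow> z \<sqsubseteq> x;
    \<And>y. \<lbrakk>y \<in> carrier L; \<And>x. x \<in> S \<Longrightarrow> y \<sqsubseteq> x\<rbrakk> \<Longrightarrow> y \<sqsubseteq> z\<rbrakk> \<Longrightarrow> \<Sqinter>S = z"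
  by (intro le_antisym) (simp_all add: le_inf_iff inf_lower)

end

context complete_boolean_lattice
begin

text \<open>In a distributive lattice complements are unique, so the definite description in the definition of
  \<^const>\<open>complement\<close> denotes the complement.\<close>

lemma complement_unique:
  assumes [simp]: "x \<in> carrier L" "y \<in> carrier L" "z \<in> carrier L"
    and y: "x \<sqinter> y = \<bottom>" "x \<squnion> y = \<top>" and z: "x \<sqinter> z = \<bottom>" "x \<squnion> z = \<top>"
  shows "y = z"
proof -
  have le: "v \<sqsubseteq> w" if [simp]: "v \<in> carrier L" "w \<in> carrier L"
    and "x \<sqinter> v = \<bottom>" "x \<squnion> w = \<top>" for v w
  proof -
    have "v = v \<sqinter> (x \<squnion> w)" using that by (simp add: meet_top)
    also have "\<dots> = v \<sqinter> x \<squnion> v \<sqinter> w" by (rule distrib) simp_all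
    also have "\<dots> \<sqsubseteq> w" using that meet_comm[of L v x] by (simp add: join_le_iff meet_right)
    finally show ?thesis .
  qed
  show ?thesis by (rule le_antisym[OF le le]) (simp_all add: y z)
qed

lemma complement_props:
  assumes "x \<in> carrier L"
  shows "\<sim> x \<in> carrier L \<and> x \<sqinter> \<sim> x = \<bottom> \<and> x \<squnion> \<sim> x = \<top>"
  unfolding complement_def
  by (rule theI') (use complemented[OF assms] complement_unique[OF assms] in blast)

lemma complement_closed [simp]: "x \<in> carrier L \<Longrightarrow> \<sim> x \<in> carrier L"
  and meet_complement: "x \<in> carrier L \<Longrightarrow> x \<sqinter> \<sim> x = \<bottom>"
  and join_complement: "x \<in> carrier L \<Longrightarrow> x \<squnion> \<sim> x = \<top>"
  using complement_props by blast+

lemma complement_eqI: "\<lbrakk>x \<in> carrier L; y \<in> carrier L; x \<sqinter> y = \<bottom>; x \<squnion> y = \<top>\<rbrakk> \<Longrightarrow> \<sim> x = y"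
  by (rule complement_unique[of x]) (simp_all add: meet_complement join_complement)

lemma complement_complement [simp]: "x \<in> carrier L \<Longrightarrow> \<sim> (\<sim> x) = x"
  by (rule complement_eqI)
    (simp_all add: meet_comm[of L "\<sim> x"] join_comm[of L "\<sim> x"] meet_complement join_complement)

lemma complement_bottom [simp]: "\<sim> \<bottom> = \<top>"
  by (rule complement_eqI) (auto intro!: le_antisym simp: join_right meet_left)

lemma complement_top [simp]: "\<sim> \<top> = \<bottom>"
  using complement_complement[OF bottom_closed] by simp

text \<open>Residuation: as a left adjoint, \<open>\<lambda>x. x \<sqinter> y\<close> preserves all joins.\<close>

lemma meet_le_iff:
  assumes [simp]: "x \<in> carrier L" "y \<in> carrier L" "z \<in> carrier L"
  shows "x \<sqinter> y \<sqsubseteq> z \<longleftrightarrow> x \<sqsubseteq> \<sim> y \<squnion> z"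
proof
  assume le: "x \<sqinter> y \<sqsubseteq> z"
  have "x = x \<sqinter> (\<sim> y \<squnion> y)" by (simp add: join_comm[of L "\<sim> y"] join_complement meet_top)
  also have "\<dots> = x \<sqinter> \<sim> y \<squnion> x \<sqinter> y" by (rule distrib) simp_all
  also have "\<dots> \<sqsubseteq> \<sim> y \<squnion> z"
    using le by (auto simp: join_le_iff intro: le_trans[OF meet_right join_left] le_trans[OF _ join_right])
  finally show "x \<sqsubseteq> \<sim> y \<squnion> z" .
next
  assume le: "x \<sqsubseteq> \<sim> y \<squnion> z"
  have "x \<sqinter> y \<sqsubseteq> y \<sqinter> (\<sim> y \<squnion> z)"
    using le by (auto simp: le_meet_iff meet_right intro: le_trans[OF meet_left])
  also have "y \<sqinter> (\<sim> y \<squnion> z) = y \<sqinter> \<sim> y \<squnion> y \<sqinter> z" by (rule distrib) simp_all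
  also have "\<dots> \<sqsubseteq> z" by (simp add: meet_complement join_le_iff meet_right)
  finally show "x \<sqinter> y \<sqsubseteq> z" by simp
qed

lemma meet_eq_bottom_iff:
  assumes "x \<in> carrier L" "y \<in> carrier L"
  shows "x \<sqinter> y = \<bottom> \<longleftrightarrow> x \<sqsubseteq> \<sim> y"
proof -
  have "\<sim> y \<squnion> \<bottom> = \<sim> y" using assms by (intro le_antisym) (simp_all add: join_le_iff join_left)
  then show ?thesis
    using meet_le_iff[of x y \<bottom>] assms by (simp add: le_bottom_iff)
qed

lemma complement_le_iff: "\<lbrakk>x \<in> carrier L; y \<in> carrier L\<rbrakk> \<Longrightarrow> \<sim> x \<sqsubseteq> \<sim> y \<longleftrightarrow> y \<sqsubseteq> x"
  using meet_eq_bottom_iff[of "\<sim> x" y] meet_eq_bottom_iff[of y "\<sim> x"] meet_comm[of L y "\<sim> x"]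
  by simp

lemma complement_join: 
  assumes "x \<in> carrier L" "y \<in> carrier L"
  shows "\<sim> (x \<squnion> y) = \<sim> x \<sqinter> \<sim> y"
proof (rule le_antisym)
  show "\<sim> (x \<squnion> y) \<sqsubseteq> \<sim> x \<sqinter> \<sim> y"
    using assms by (simp add: le_meet_iff complement_le_iff join_left join_right)
  have "x \<squnion> y \<sqsubseteq> \<sim> (\<sim> x \<sqinter> \<sim> y)"
    using assms complement_le_iff[of "\<sim> x" "\<sim> x \<sqinter> \<sim> y"] complement_le_iff[of "\<sim> y" "\<sim> x \<sqinter> \<sim> y"]
    by (simp add: join_le_iff meet_left meet_right)
  then show "\<sim> x \<sqinter> \<sim> y \<sqsubseteq> \<sim> (x \<squnion> y)"
    using assms complement_le_iff[of "\<sim> (\<sim> x \<sqinter> \<sim> y)" "x \<squnion> y"] by simp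
qed (use assms in simp_all)

text \<open>The half of the infinite distributive law \<open>\<Squnion>S \<sqinter> \<Squnion>T = \<Squnion>{s \<sqinter> t}\<close> that is not automatic, by residuating
  in each argument.\<close>

lemma sup_meet_sup_le:
  assumes S: "S \<subseteq> carrier L" and T: "T \<subseteq> carrier L" and z: "z \<in> carrier L"
    and le: "\<And>s t. \<lbrakk>s \<in> S; t \<in> T\<rbrakk> \<Longrightarrow> s \<sqinter> t \<sqsubseteq> z"
  shows "\<Squnion>S \<sqinter> \<Squnion>T \<sqsubseteq> z"
proof -
  have "s \<sqinter> \<Squnion>T \<sqsubseteq> z" if s: "s \<in> S" for s
  proof -
    have s': "s \<in> carrier L" using s S by blast
    have "\<Squnion>T \<sqsubseteq> \<sim> s \<squnion> z"
      using T z s' le[OF s] meet_le_iff[of _ s z] meet_comm[of L s]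
      by (subst sup_le_iff) (simp_all, blast)
    then show ?thesis
      using meet_le_iff[of "\<Squnion>T" s z] T z s' by (simp add: meet_comm[of L s])
  qed
  then have "\<Squnion>S \<sqsubseteq> \<sim> (\<Squnion>T) \<squnion> z"
    using S T z meet_le_iff[of _ "\<Squnion>T" z] by (subst sup_le_iff) (simp_all, blast)
  then show ?thesis using S T z by (simp add: meet_le_iff)
qed

text \<open>An atom behaves like a point: it lies either below \<open>x\<close> or below \<open>\<sim> x\<close>, since its meet with \<open>x\<close> is the
  atom itself or \<open>\<bottom>\<close>. In an atomic algebra, elements can therefore be compared by the atoms below them.\<close>

lemma atom_le_complement_iff:
  assumes a: "atom L a" and x: "x \<in> carrier L"
  shows "a \<sqsubseteq> \<sim> x \<longleftrightarrow> \<not> a \<sqsubseteq> x"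
proof -
  have ac: "a \<in> carrier L" "a \<noteq> \<bottom>" using a by (auto simp: atom_def)
  have "a \<sqinter> x \<sqsubseteq> a" using ac x by (simp add: meet_left)
  then have "a \<sqinter> x = \<bottom> \<or> a \<sqinter> x = a" using a x by (simp add: atom_def)
  moreover have "a \<sqinter> x = a \<longleftrightarrow> a \<sqsubseteq> x" using le_iff_join[OF ac(1) x] by auto
  ultimately show ?thesis using meet_eq_bottom_iff[OF ac(1) x] ac(2) by auto
qed

lemma atom_le_sup_iff:
  assumes a: "atom L a" and S: "S \<subseteq> carrier L"
  shows "a \<sqsubseteq> \<Squnion>S \<longleftrightarrow> (\<exists>s\<in>S. a \<sqsubseteq> s)"
proof
  have ac: "a \<in> carrier L" "a \<noteq> \<bottom>" using a by (auto simp: atom_def)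
  show "\<exists>s\<in>S. a \<sqsubseteq> s" if le: "a \<sqsubseteq> \<Squnion>S"
  proof (rule ccontr)
    assume "\<not> (\<exists>s\<in>S. a \<sqsubseteq> s)"
    then have "a \<sqsubseteq> \<sim> s" if "s \<in> S" for s
      using that S atom_le_complement_iff[OF a, of s] by auto
    then have "s \<sqsubseteq> \<sim> a" if "s \<in> S" for s
      using that S ac complement_le_iff[of "\<sim> s" a] subsetD[OF S that] by simp
    then have "a \<sqsubseteq> \<sim> a" using le S ac by (intro le_trans[OF le]) (simp_all add: sup_le_iff)
    then show False using atom_le_complement_iff[OF a] ac by simp
  qed
  show "a \<sqsubseteq> \<Squnion>S" if "\<exists>s\<in>S. a \<sqsubseteq> s"
    using that S ac(1) by (auto intro: le_trans[OF _ sup_upper[OF S]])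
qed

lemma atom_le_atom: "\<lbrakk>atom L a; atom L b; a \<sqsubseteq> b\<rbrakk> \<Longrightarrow> a = b"
  unfolding atom_def by blast

lemma le_iff_atoms:
  assumes "atomic L" "x \<in> carrier L" "y \<in> carrier L"
  shows "x \<sqsubseteq> y \<longleftrightarrow> (\<forall>a. atom L a \<longrightarrow> a \<sqsubseteq> x \<longrightarrow> a \<sqsubseteq> y)"
proof
  show "\<forall>a. atom L a \<longrightarrow> a \<sqsubseteq> x \<longrightarrow> a \<sqsubseteq> y" if "x \<sqsubseteq> y"
    using that assms unfolding atom_def by (meson le_trans)
next
  assume all: "\<forall>a. atom L a \<longrightarrow> a \<sqsubseteq> x \<longrightarrow> a \<sqsubseteq> y"
  show "x \<sqsubseteq> y"
  proof (rule ccontr)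
    assume "\<not> x \<sqsubseteq> y"
    then have "x \<sqinter> \<sim> y \<noteq> \<bottom>" using assms meet_eq_bottom_iff[of x "\<sim> y"] by simp
    then obtain a where a: "atom L a" "a \<sqsubseteq> x \<sqinter> \<sim> y" using assms unfolding atomic_def by force
    have "a \<in> carrier L" using a by (simp add: atom_def)
    then have "a \<sqsubseteq> x" "a \<sqsubseteq> \<sim> y" using a(2) assms by (simp_all add: le_meet_iff)
    then show False using all a(1) atom_le_complement_iff[OF a(1)] assms by blast
  qed
qed

lemma eq_if_same_atoms:
  assumes "atomic L" "x \<in> carrier L" "y \<in> carrier L"
    and "\<And>a. atom L a \<Longrightarrow> a \<sqsubseteq> x \<longleftrightarrow> a \<sqsubseteq> y"
  shows "x = y"
proof (rule le_antisym)
  show "x \<sqsubseteq> y" "y \<sqsubseteq> x"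
    using assms(4) le_iff_atoms[OF assms(1,2,3)] le_iff_atoms[OF assms(1,3,2)] by metis+
qed (fact assms)+

end

section \<open>The category of de Vries algebras\<close>

context de_vries_algebra
begin

lemma bottom_prox:
  assumes "b \<in> carrier L"
  shows "\<bottom> \<prec> b"
proof -
  have "\<bottom> \<prec> \<bottom>" using DV5[OF _ _ DV1] by simp
  then show ?thesis using DV3[of \<bottom> \<bottom> \<bottom> b] assms by simp
qed

lemma prox_top: "a \<in> carrier L \<Longrightarrow> a \<prec> \<top>"
  using DV3[of a \<top> \<top> \<top>] DV1 by simp

lemma prox_bottomD: "\<lbrakk>a \<in> carrier L; a \<prec> \<bottom>\<rbrakk> \<Longrightarrow> a = \<bottom>"
  using DV2[of a \<bottom>] by (simp add: le_bottom_iff)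

lemma prox_le_trans: "\<lbrakk>a \<in> carrier L; b \<in> carrier L; c \<in> carrier L; a \<prec> b; b \<sqsubseteq> c\<rbrakk> \<Longrightarrow> a \<prec> c"
  using DV3[of a a b c] by simp

lemma le_prox_trans: "\<lbrakk>a \<in> carrier L; b \<in> carrier L; c \<in> carrier L; a \<sqsubseteq> b; b \<prec> c\<rbrakk> \<Longrightarrow> a \<prec> c"
  using DV3[of a b c c] by simp

lemma meet_prox_meet:
  assumes "a \<in> carrier L" "b \<in> carrier L" "c \<in> carrier L" "d \<in> carrier L" "a \<prec> b" "c \<prec> d"
  shows "a \<sqinter> c \<prec> b \<sqinter> d"
  using assms le_prox_trans[of "a \<sqinter> c" a b] le_prox_trans[of "a \<sqinter> c" c d]
  by (intro DV4) (simp_all add: meet_left meet_right)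

end

locale dv_map = dom: de_vries_algebra A + cod: de_vries_algebra B
  for A :: "'a devries" and B :: "'b devries" +
  fixes \<rho> :: "'a \<Rightarrow> 'b"
  assumes morphism: "de_vries_morphism A B \<rho>"
begin

lemma extensional: "\<rho> \<in> extensional (carrier A)"
  and closed [simp]: "a \<in> carrier A \<Longrightarrow> \<rho> a \<in> carrier B"
  and map_bottom [simp]: "\<rho> \<bottom>\<^bsub>A\<^esub> = \<bottom>\<^bsub>B\<^esub>"
  and map_meet: "\<lbrakk>a \<in> carrier A; b \<in> carrier A\<rbrakk> \<Longrightarrow> \<rho> (a \<sqinter>\<^bsub>A\<^esub> b) = \<rho> a \<sqinter>\<^bsub>B\<^esub> \<rho> b"
  and map_prox: "\<lbrakk>a \<in> carrier A; b \<in> carrier A; a \<prec>\<^bsub>A\<^esub> b\<rbrakk> \<Longrightarrow> \<sim>\<^bsub>B\<^esub> \<rho> (\<sim>\<^bsub>A\<^esub> a) \<prec>\<^bsub>B\<^esub> \<rho> b"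
  and map_sup: "b \<in> carrier A \<Longrightarrow> \<rho> b = \<Squnion>\<^bsub>B\<^esub> (\<rho> ` {a \<in> carrier A. a \<prec>\<^bsub>A\<^esub> b})"
  using morphism unfolding de_vries_morphism_def PiE_iff by blast+

lemma mono: "\<lbrakk>a \<in> carrier A; b \<in> carrier A; a \<sqsubseteq>\<^bsub>A\<^esub> b\<rbrakk> \<Longrightarrow> \<rho> a \<sqsubseteq>\<^bsub>B\<^esub> \<rho> b"
  using dom.le_iff_join[of a b] map_meet[of a b] cod.meet_right[of "\<rho> a" "\<rho> b"] by simp

text \<open>A morphism lies below its dual \<open>\<lambda>a. \<sim> \<rho> (\<sim> a)\<close>, because it preserves binary meets and bottom. With the
  third axiom for morphisms, this makes it preserve proximity.\<close>

lemma le_dual: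
  assumes "a \<in> carrier A"
  shows "\<rho> a \<sqsubseteq>\<^bsub>B\<^esub> \<sim>\<^bsub>B\<^esub> \<rho> (\<sim>\<^bsub>A\<^esub> a)"
  using assms map_meet[of a "\<sim>\<^bsub>A\<^esub> a"] cod.meet_eq_bottom_iff[of "\<rho> a" "\<rho> (\<sim>\<^bsub>A\<^esub> a)"]
  by (simp add: dom.meet_complement)

lemma prox_mono: "\<lbrakk>a \<in> carrier A; b \<in> carrier A; a \<prec>\<^bsub>A\<^esub> b\<rbrakk> \<Longrightarrow> \<rho> a \<prec>\<^bsub>B\<^esub> \<rho> b"
  using cod.le_prox_trans[OF _ _ _ le_dual map_prox, of a b] by simp

lemma map_top [simp]: "\<rho> \<top>\<^bsub>A\<^esub> = \<top>\<^bsub>B\<^esub>"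
  using cod.DV2[OF _ _ map_prox[OF _ _ dom.DV1]] by (simp add: cod.top_le_iff)

end

lemma dv_mapI: "\<lbrakk>de_vries_algebra A; de_vries_algebra B; de_vries_morphism A B \<rho>\<rbrakk> \<Longrightarrow> dv_map A B \<rho>"
  by (simp add: dv_map_def dv_map_axioms_def)

lemma restrict_id_morphism:
  assumes "de_vries_algebra A"
  shows "de_vries_morphism A A (\<lambda>a\<in>carrier A. a)"
proof -
  interpret de_vries_algebra A by fact
  have "(\<lambda>a\<in>carrier A. a) ` {a \<in> carrier A. a \<prec>\<^bsub>A\<^esub> b} = {a \<in> carrier A. a \<prec>\<^bsub>A\<^esub> b}" for b
    by auto
  then show ?thesis unfolding de_vries_morphism_def by (auto intro: DV7)
qed

text \<open>The pointwise composite \<open>\<rho>\<^sub>2 \<circ> \<rho>\<^sub>1\<close> may violate the fourth axiom for morphisms. The composite of the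
  category is its lower regularisation: it lies below the pointwise composite, and above the values
  of the pointwise composite at all elements \<open>a \<prec> b\<close>. The axioms that involve \<open>\<prec>\<close> are transferred from
  the pointwise composite by interpolating \<open>\<prec>\<close> once or twice.\<close>

locale dv_composite = f: dv_map A B \<rho>\<^sub>1 + g: dv_map B C \<rho>\<^sub>2
  for A :: "'a devries" and B :: "'b devries" and C :: "'c devries" and \<rho>\<^sub>1 \<rho>\<^sub>2
begin

abbreviation "\<rho> \<equiv> dv_comp A C \<rho>\<^sub>2 \<rho>\<^sub>1"

lemma comp_eq: "b \<in> carrier A \<Longrightarrow> \<rho> b = \<Squnion>\<^bsub>C\<^esub> ((\<lambda>a. \<rho>\<^sub>2 (\<rho>\<^sub>1 a)) ` {a \<in> carrier A. a \<prec>\<^bsub>A\<^esub> b})"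
  by (simp add: dv_comp_def)

lemma comp_closed [simp]: "b \<in> carrier A \<Longrightarrow> \<rho> b \<in> carrier C"
  by (auto simp: comp_eq intro!: g.cod.sup_closed)

lemma comp_le_iff: "\<lbrakk>b \<in> carrier A; z \<in> carrier C\<rbrakk> \<Longrightarrow>
    \<rho> b \<sqsubseteq>\<^bsub>C\<^esub> z \<longleftrightarrow> (\<forall>a\<in>carrier A. a \<prec>\<^bsub>A\<^esub> b \<longrightarrow> \<rho>\<^sub>2 (\<rho>\<^sub>1 a) \<sqsubseteq>\<^bsub>C\<^esub> z)"
  by (subst comp_eq, simp, subst g.cod.sup_le_iff) auto

lemma comp_upper: "\<lbrakk>a \<in> carrier A; b \<in> carrier A; a \<prec>\<^bsub>A\<^esub> b\<rbrakk> \<Longrightarrow> \<rho>\<^sub>2 (\<rho>\<^sub>1 a) \<sqsubseteq>\<^bsub>C\<^esub> \<rho> b"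
  using comp_le_iff[of b "\<rho> b"] by simp

lemma comp_le: "b \<in> carrier A \<Longrightarrow> \<rho> b \<sqsubseteq>\<^bsub>C\<^esub> \<rho>\<^sub>2 (\<rho>\<^sub>1 b)"
  by (simp add: comp_le_iff) (meson f.mono g.mono f.closed f.dom.DV2)

lemma comp_mono: "\<lbrakk>a \<in> carrier A; b \<in> carrier A; a \<sqsubseteq>\<^bsub>A\<^esub> b\<rbrakk> \<Longrightarrow> \<rho> a \<sqsubseteq>\<^bsub>C\<^esub> \<rho> b"
  by (simp add: comp_le_iff) (meson comp_upper f.dom.prox_le_trans)

lemma comp_morphism: "de_vries_morphism A C \<rho>"
  unfolding de_vries_morphism_def
proof (intro conjI ballI impI)
  show "\<rho> \<in> carrier A \<rightarrow>\<^sub>E carrier C" by (auto simp: PiE_iff dv_comp_def intro!: g.cod.sup_closed)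
  show "\<rho> \<bottom>\<^bsub>A\<^esub> = \<bottom>\<^bsub>C\<^esub>"
    using comp_le[of "\<bottom>\<^bsub>A\<^esub>"] by (simp add: g.cod.le_bottom_iff)
next
  fix a b assume [simp]: "a \<in> carrier A" "b \<in> carrier A"
  show "\<rho> (a \<sqinter>\<^bsub>A\<^esub> b) = \<rho> a \<sqinter>\<^bsub>C\<^esub> \<rho> b"
  proof (rule g.cod.le_antisym)
    show "\<rho> (a \<sqinter>\<^bsub>A\<^esub> b) \<sqsubseteq>\<^bsub>C\<^esub> \<rho> a \<sqinter>\<^bsub>C\<^esub> \<rho> b"
      by (simp add: g.cod.le_meet_iff comp_mono f.dom.meet_left f.dom.meet_right)
    show "\<rho> a \<sqinter>\<^bsub>C\<^esub> \<rho> b \<sqsubseteq>\<^bsub>C\<^esub> \<rho> (a \<sqinter>\<^bsub>A\<^esub> b)"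
      unfolding comp_eq[OF \<open>a \<in> carrier A\<close>] comp_eq[OF \<open>b \<in> carrier A\<close>]
    proof (rule g.cod.sup_meet_sup_le)
      fix s t
      assume "s \<in> (\<lambda>a. \<rho>\<^sub>2 (\<rho>\<^sub>1 a)) ` {c \<in> carrier A. c \<prec>\<^bsub>A\<^esub> a}"
        "t \<in> (\<lambda>a. \<rho>\<^sub>2 (\<rho>\<^sub>1 a)) ` {c \<in> carrier A. c \<prec>\<^bsub>A\<^esub> b}"
      then obtain c d where cd: "c \<in> carrier A" "c \<prec>\<^bsub>A\<^esub> a" "s = \<rho>\<^sub>2 (\<rho>\<^sub>1 c)"
        "d \<in> carrier A" "d \<prec>\<^bsub>A\<^esub> b" "t = \<rho>\<^sub>2 (\<rho>\<^sub>1 d)" by blast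
      then have "s \<sqinter>\<^bsub>C\<^esub> t = \<rho>\<^sub>2 (\<rho>\<^sub>1 (c \<sqinter>\<^bsub>A\<^esub> d))" by (simp add: f.map_meet g.map_meet)
      also have "\<dots> \<sqsubseteq>\<^bsub>C\<^esub> \<rho> (a \<sqinter>\<^bsub>A\<^esub> b)"
        using cd by (intro comp_upper) (simp_all add: f.dom.meet_prox_meet)
      finally show "s \<sqinter>\<^bsub>C\<^esub> t \<sqsubseteq>\<^bsub>C\<^esub> \<rho> (a \<sqinter>\<^bsub>A\<^esub> b)" .
    qed auto
  qed simp_all
next
  fix a b assume [simp]: "a \<in> carrier A" "b \<in> carrier A" and ab: "a \<prec>\<^bsub>A\<^esub> b"
  obtain d where d [simp]: "d \<in> carrier A" and ad: "a \<prec>\<^bsub>A\<^esub> d" "d \<prec>\<^bsub>A\<^esub> b"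
    using f.dom.DV6[OF _ _ ab] by auto
  obtain c where c [simp]: "c \<in> carrier A" and ac: "a \<prec>\<^bsub>A\<^esub> c" "c \<prec>\<^bsub>A\<^esub> d"
    using f.dom.DV6[OF _ _ ad(1)] by auto
  have "\<rho>\<^sub>2 (\<rho>\<^sub>1 (\<sim>\<^bsub>A\<^esub> c)) \<sqsubseteq>\<^bsub>C\<^esub> \<rho> (\<sim>\<^bsub>A\<^esub> a)"
    by (rule comp_upper) (simp_all add: f.dom.DV5 ac)
  then have 1: "\<sim>\<^bsub>C\<^esub> \<rho> (\<sim>\<^bsub>A\<^esub> a) \<sqsubseteq>\<^bsub>C\<^esub> \<sim>\<^bsub>C\<^esub> \<rho>\<^sub>2 (\<rho>\<^sub>1 (\<sim>\<^bsub>A\<^esub> c))"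
    by (simp add: g.cod.complement_le_iff)
  have 2: "\<sim>\<^bsub>C\<^esub> \<rho>\<^sub>2 (\<rho>\<^sub>1 (\<sim>\<^bsub>A\<^esub> c)) \<prec>\<^bsub>C\<^esub> \<rho>\<^sub>2 (\<rho>\<^sub>1 d)"
    using g.map_prox[OF _ _ f.map_prox[OF c d ac(2)]] by simp
  show "\<sim>\<^bsub>C\<^esub> \<rho> (\<sim>\<^bsub>A\<^esub> a) \<prec>\<^bsub>C\<^esub> \<rho> b"
    using g.cod.DV3[OF _ _ _ _ 1 2 comp_upper[OF d _ ad(2)]] by simp
next
  fix b assume [simp]: "b \<in> carrier A"
  show "\<rho> b = \<Squnion>\<^bsub>C\<^esub> (\<rho> ` {a \<in> carrier A. a \<prec>\<^bsub>A\<^esub> b})"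
  proof (rule g.cod.sup_eqI[symmetric])
    show "x \<sqsubseteq>\<^bsub>C\<^esub> \<rho> b" if "x \<in> \<rho> ` {a \<in> carrier A. a \<prec>\<^bsub>A\<^esub> b}" for x
      using that by (auto intro!: comp_mono f.dom.DV2)
  next
    fix y assume [simp]: "y \<in> carrier C"
      and ub: "\<And>x. x \<in> \<rho> ` {a \<in> carrier A. a \<prec>\<^bsub>A\<^esub> b} \<Longrightarrow> x \<sqsubseteq>\<^bsub>C\<^esub> y"
    show "\<rho> b \<sqsubseteq>\<^bsub>C\<^esub> y"
    proof (simp add: comp_le_iff, intro ballI impI)
      fix a assume [simp]: "a \<in> carrier A" and "a \<prec>\<^bsub>A\<^esub> b"
      then obtain c where c [simp]: "c \<in> carrier A" and ac: "a \<prec>\<^bsub>A\<^esub> c" "c \<prec>\<^bsub>A\<^esub> b"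
        using f.dom.DV6[of a b] by auto
      show "\<rho>\<^sub>2 (\<rho>\<^sub>1 a) \<sqsubseteq>\<^bsub>C\<^esub> y"
        by (rule g.cod.le_trans[OF comp_upper[OF _ c ac(1)] ub]) (use ac in auto)
    qed
  qed auto
qed

sublocale comp: dv_map A C \<rho>
  by unfold_locales (rule comp_morphism)

end

lemma dv_compositeI: "\<lbrakk>dv_map A B \<rho>\<^sub>1; dv_map B C \<rho>\<^sub>2\<rbrakk> \<Longrightarrow> dv_composite A B C \<rho>\<^sub>1 \<rho>\<^sub>2"
  by (simp add: dv_composite_def)

text \<open>Both bracketings are the join of \<open>\<rho>\<^sub>3 (\<rho>\<^sub>2 (\<rho>\<^sub>1 a))\<close> over \<open>a \<prec> b\<close>: interpolating
  \<open>a \<prec> c \<prec> b\<close> absorbs the inner join; on the left-hand side this uses \<open>\<rho>\<^sub>1 a \<prec> \<rho>\<^sub>1 c\<close>.\<close>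

lemma dv_comp_assoc:
  assumes 1: "dv_map A B \<rho>\<^sub>1" and 2: "dv_map B C \<rho>\<^sub>2" and 3: "dv_map C D \<rho>\<^sub>3"
  shows "dv_comp A D (dv_comp B D \<rho>\<^sub>3 \<rho>\<^sub>2) \<rho>\<^sub>1 = dv_comp A D \<rho>\<^sub>3 (dv_comp A C \<rho>\<^sub>2 \<rho>\<^sub>1)"
proof -
  interpret f: dv_composite A B C \<rho>\<^sub>1 \<rho>\<^sub>2 using 1 2 by (rule dv_compositeI)
  interpret g: dv_composite B C D \<rho>\<^sub>2 \<rho>\<^sub>3 using 2 3 by (rule dv_compositeI)
  interpret l: dv_composite A B D \<rho>\<^sub>1 "dv_comp B D \<rho>\<^sub>3 \<rho>\<^sub>2"
    by (rule dv_compositeI[OF 1]) (rule g.comp.dv_map_axioms)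
  interpret r: dv_composite A C D "dv_comp A C \<rho>\<^sub>2 \<rho>\<^sub>1" \<rho>\<^sub>3
    by (rule dv_compositeI[OF _ 3]) (rule f.comp.dv_map_axioms)
  show ?thesis
  proof (rule extensionalityI[OF l.comp.extensional r.comp.extensional])
    fix b assume [simp]: "b \<in> carrier A"
    show "l.\<rho> b = r.\<rho> b"
    proof (rule g.g.cod.le_antisym)
      show "l.\<rho> b \<sqsubseteq>\<^bsub>D\<^esub> r.\<rho> b"
      proof (simp add: l.comp_le_iff, intro ballI impI)
        fix a assume [simp]: "a \<in> carrier A" and "a \<prec>\<^bsub>A\<^esub> b"
        then obtain c where c [simp]: "c \<in> carrier A" and ac: "a \<prec>\<^bsub>A\<^esub> c" "c \<prec>\<^bsub>A\<^esub> b"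
          using f.f.dom.DV6[of a b] by auto
        have "g.\<rho> (\<rho>\<^sub>1 a) \<sqsubseteq>\<^bsub>D\<^esub> \<rho>\<^sub>3 (\<rho>\<^sub>2 (\<rho>\<^sub>1 a))" by (simp add: g.comp_le)
        also have "\<dots> \<sqsubseteq>\<^bsub>D\<^esub> \<rho>\<^sub>3 (f.\<rho> c)"
          using ac by (intro g.g.mono f.comp_upper) simp_all
        also have "\<dots> \<sqsubseteq>\<^bsub>D\<^esub> r.\<rho> b" using ac by (intro r.comp_upper) simp_all
        finally show "g.\<rho> (\<rho>\<^sub>1 a) \<sqsubseteq>\<^bsub>D\<^esub> r.\<rho> b" by simp
      qed
      show "r.\<rho> b \<sqsubseteq>\<^bsub>D\<^esub> l.\<rho> b"
      proof (simp add: r.comp_le_iff, intro ballI impI)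
        fix a assume [simp]: "a \<in> carrier A" and "a \<prec>\<^bsub>A\<^esub> b"
        then obtain c where c [simp]: "c \<in> carrier A" and ac: "a \<prec>\<^bsub>A\<^esub> c" "c \<prec>\<^bsub>A\<^esub> b"
          using f.f.dom.DV6[of a b] by auto
        have "\<rho>\<^sub>3 (f.\<rho> a) \<sqsubseteq>\<^bsub>D\<^esub> \<rho>\<^sub>3 (\<rho>\<^sub>2 (\<rho>\<^sub>1 a))" by (intro g.g.mono f.comp_le) simp_all
        also have "\<dots> \<sqsubseteq>\<^bsub>D\<^esub> g.\<rho> (\<rho>\<^sub>1 c)"
          using ac by (intro g.comp_upper f.f.prox_mono) simp_all
        also have "\<dots> \<sqsubseteq>\<^bsub>D\<^esub> l.\<rho> b" using ac by (intro l.comp_upper) simp_all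
        finally show "\<rho>\<^sub>3 (f.\<rho> a) \<sqsubseteq>\<^bsub>D\<^esub> l.\<rho> b" by simp
      qed
    qed simp_all
  qed
qed

lemma dv_comp_id:
  assumes "dv_map A B \<rho>"
  shows "dv_comp A B \<rho> (\<lambda>a\<in>carrier A. a) = \<rho>" and "dv_comp A B (\<lambda>b\<in>carrier B. b) \<rho> = \<rho>"
proof -
  interpret dv_map A B \<rho> by fact
  have "dv_comp A B \<rho> (\<lambda>a\<in>carrier A. a) = restrict \<rho> (carrier A)"
    "dv_comp A B (\<lambda>b\<in>carrier B. b) \<rho> = restrict \<rho> (carrier A)"
    unfolding dv_comp_def by (auto intro!: restrict_ext simp: map_sup[symmetric] cong: image_cong_simp)
  then show "dv_comp A B \<rho> (\<lambda>a\<in>carrier A. a) = \<rho>" "dv_comp A B (\<lambda>b\<in>carrier B. b) \<rho> = \<rho>"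
    by (simp_all add: extensional_restrict[OF extensional])
qed

lemma DeV_simps:
  "Obj DeV = Collect de_vries_algebra"
  "Hom DeV = (\<lambda>A B. Collect (de_vries_morphism A B))"
  "Id DeV = (\<lambda>A. \<lambda>a\<in>carrier A. a)"
  "Comp DeV = (\<lambda>A1 A2 A3 \<rho>2 \<rho>1. dv_comp A1 A3 \<rho>2 \<rho>1)"
  by (simp_all add: DeV_def)

lemma is_category_DeV: "is_category DeV"
  unfolding is_category_def DeV_simps
proof (intro conjI ballI; clarsimp)
  show "de_vries_morphism A A (\<lambda>a\<in>carrier A. a)" if "de_vries_algebra A" for A :: "'a devries"
    using that by (rule restrict_id_morphism)
  show "de_vries_morphism A C (dv_comp A C g f)"
    if "de_vries_algebra A" "de_vries_algebra B" "de_vries_algebra C"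
      "de_vries_morphism A B f" "de_vries_morphism B C g" for A B C :: "'a devries" and f g
    using that by (meson dv_composite.comp_morphism dv_compositeI dv_mapI)
  show "dv_comp A B f (\<lambda>a\<in>carrier A. a) = f" "dv_comp A B (\<lambda>b\<in>carrier B. b) f = f"
    if "de_vries_algebra A" "de_vries_algebra B" "de_vries_morphism A B f" 
    for A B :: "'a devries" and f
    using that by (simp_all add: dv_comp_id dv_mapI)
  show "dv_comp A D (dv_comp B D h g) f = dv_comp A D h (dv_comp A C g f)"
    if "de_vries_algebra A" "de_vries_algebra B" "de_vries_algebra C" "de_vries_algebra D"
      "de_vries_morphism A B f" "de_vries_morphism B C g" "de_vries_morphism C D h"
    for A B C D :: "'a devries" and f g h
    using that by (simp add: dv_comp_assoc[where B = B and C = C] dv_mapI)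
qed

section \<open>The category of de Vries extensions\<close>

lemma complete_boolean_homD:
  assumes "complete_boolean_hom A B \<sigma>"
  shows "\<sigma> \<in> extensional (carrier A)" "a \<in> carrier A \<Longrightarrow> \<sigma> a \<in> carrier B"
    "S \<subseteq> carrier A \<Longrightarrow> \<sigma> (\<Squnion>\<^bsub>A\<^esub> S) = \<Squnion>\<^bsub>B\<^esub> (\<sigma> ` S)"
    "S \<subseteq> carrier A \<Longrightarrow> \<sigma> (\<Sqinter>\<^bsub>A\<^esub> S) = \<Sqinter>\<^bsub>B\<^esub> (\<sigma> ` S)"
    "a \<in> carrier A \<Longrightarrow> \<sigma> (\<sim>\<^bsub>A\<^esub> a) = \<sim>\<^bsub>B\<^esub> (\<sigma> a)"
  using assms unfolding complete_boolean_hom_def by (auto simp: PiE_iff)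

lemma restrict_id_complete_boolean_hom:
  assumes "complete_boolean_lattice B"
  shows "complete_boolean_hom B B (\<lambda>b\<in>carrier B. b)"
proof -
  interpret complete_boolean_lattice B by fact
  have "(\<lambda>b\<in>carrier B. b) ` S = S" if "S \<subseteq> carrier B" for S using that by (auto simp: image_iff)
  then show ?thesis unfolding complete_boolean_hom_def by auto
qed

lemma compose_complete_boolean_hom:
  assumes \<sigma>: "complete_boolean_hom A B \<sigma>" and \<tau>: "complete_boolean_hom B C \<tau>"
    and "complete_boolean_lattice A"
  shows "complete_boolean_hom A C (compose (carrier A) \<tau> \<sigma>)"
proof -
  interpret complete_boolean_lattice A by fact
  have im: "compose (carrier A) \<tau> \<sigma> ` S = \<tau> ` (\<sigma> ` S)" if "S \<subseteq> carrier A" for S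
    using that by (auto simp: compose_def image_iff subset_iff)
  have sub: "\<sigma> ` S \<subseteq> carrier B" if "S \<subseteq> carrier A" for S
    using that complete_boolean_homD(2)[OF \<sigma>] by blast
  show ?thesis
    unfolding complete_boolean_hom_def
    by (auto simp: im sub compose_eq complete_boolean_homD[OF \<sigma>] complete_boolean_homD[OF \<tau>])
      (auto simp: compose_def complete_boolean_homD[OF \<sigma>] complete_boolean_homD[OF \<tau>])
qed

locale dv_extension =
  fixes E :: "('a, 'b) dv_ext"
  assumes extension: "de_vries_extension E"
begin

abbreviation "A \<equiv> src E"
abbreviation "B \<equiv> tgt E"
abbreviation "\<alpha> \<equiv> emb E"

sublocale emb: dv_map A B \<alpha>
  using extension unfolding de_vries_extension_def by (intro dv_mapI) blast+

lemma inj: "inj_on \<alpha> (carrier A)"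
  and atomic: "atomic B"
  and prox_iff: "\<lbrakk>a \<in> carrier B; b \<in> carrier B\<rbrakk> \<Longrightarrow> a \<prec>\<^bsub>B\<^esub> b \<longleftrightarrow> a \<sqsubseteq>\<^bsub>B\<^esub> b"
  and join_of_meets: "b \<in> carrier B \<Longrightarrow> \<exists>\<S>\<subseteq>Pow (\<alpha> ` carrier A). b = \<Squnion>\<^bsub>B\<^esub> ((\<lambda>S. \<Sqinter>\<^bsub>B\<^esub> S) ` \<S>)"
  using extension unfolding de_vries_extension_def extremally_disconnected_def by blast+

text \<open>A complete homomorphism is determined by its values on the elements \<open>\<alpha> a\<close>, since every element of
  \<open>B\<close> is a join of meets of these.\<close>

lemma hom_eqI:
  assumes \<sigma>: "complete_boolean_hom B C \<sigma>" and \<tau>: "complete_boolean_hom B C \<tau>"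
    and eq: "compose (carrier A) \<sigma> \<alpha> = compose (carrier A) \<tau> \<alpha>"
  shows "\<sigma> = \<tau>"
proof (rule extensionalityI[OF complete_boolean_homD(1)[OF \<sigma>] complete_boolean_homD(1)[OF \<tau>]])
  fix b assume "b \<in> carrier B"
  then obtain \<S> where \<S>: "\<S> \<subseteq> Pow (\<alpha> ` carrier A)" and b: "b = \<Squnion>\<^bsub>B\<^esub> ((\<lambda>S. \<Sqinter>\<^bsub>B\<^esub> S) ` \<S>)"
    using join_of_meets by blast
  have "\<sigma> (\<alpha> a) = \<tau> (\<alpha> a)" if "a \<in> carrier A" for a
    using fun_cong[OF eq, of a] that by (simp add: compose_eq)
  then have im: "\<sigma> ` S = \<tau> ` S" if "S \<in> \<S>" for S
    using \<S> that by (intro image_cong) auto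
  have S: "S \<subseteq> carrier B" if "S \<in> \<S>" for S using that \<S> emb.closed by blast
  then have "(\<lambda>S. \<Sqinter>\<^bsub>B\<^esub> S) ` \<S> \<subseteq> carrier B" by auto
  then show "\<sigma> b = \<tau> b"
    by (simp add: b complete_boolean_homD[OF \<sigma>] complete_boolean_homD[OF \<tau>] image_image S im
        cong: image_cong)
qed

end

lemma dv_ext_morphism_iff:
  "dv_ext_morphism E E' f \<longleftrightarrow> de_vries_morphism (src E) (src E') (fst f) \<and>
     complete_boolean_hom (tgt E) (tgt E') (snd f) \<and>
     compose (carrier (src E)) (snd f) (emb E) = dv_comp (src E) (tgt E') (emb E') (fst f)"
  by (simp add: dv_ext_morphism_def split: prod.split)

text \<open>The squares paste because \<open>\<sigma>\<^sub>2\<close> preserves the joins that define \<open>\<star>\<close>, so that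
  \<open>\<sigma>\<^sub>2 \<circ> (\<alpha>\<^sub>2 \<star> \<rho>\<^sub>1) = (\<sigma>\<^sub>2 \<circ> \<alpha>\<^sub>2) \<star> \<rho>\<^sub>1\<close>; the rest is associativity of \<open>\<star>\<close>.\<close>

lemma dv_ext_morphism_comp:
  fixes E1 E2 E3 :: "('a, 'b) dv_ext"
  assumes E: "dv_extension E1" "dv_extension E2" "dv_extension E3"
    and f: "dv_ext_morphism E1 E2 (\<rho>\<^sub>1, \<sigma>\<^sub>1)" and g: "dv_ext_morphism E2 E3 (\<rho>\<^sub>2, \<sigma>\<^sub>2)"
  shows "dv_ext_morphism E1 E3
    (dv_comp (src E1) (src E3) \<rho>\<^sub>2 \<rho>\<^sub>1, compose (carrier (tgt E1)) \<sigma>\<^sub>2 \<sigma>\<^sub>1)"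
proof -
  interpret E1: dv_extension E1 by fact
  interpret E2: dv_extension E2 by fact
  interpret E3: dv_extension E3 by fact
  from f have f1: "de_vries_morphism E1.A E2.A \<rho>\<^sub>1" and f2: "complete_boolean_hom E1.B E2.B \<sigma>\<^sub>1"
    and f3: "compose (carrier E1.A) \<sigma>\<^sub>1 E1.\<alpha> = dv_comp E1.A E2.B E2.\<alpha> \<rho>\<^sub>1"
    by (simp_all add: dv_ext_morphism_iff)
  from g have g1: "de_vries_morphism E2.A E3.A \<rho>\<^sub>2" and g2: "complete_boolean_hom E2.B E3.B \<sigma>\<^sub>2"
    and g3: "compose (carrier E2.A) \<sigma>\<^sub>2 E2.\<alpha> = dv_comp E2.A E3.B E3.\<alpha> \<rho>\<^sub>2"
    by (simp_all add: dv_ext_morphism_iff)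
  have m1: "dv_map E1.A E2.A \<rho>\<^sub>1" and m2: "dv_map E2.A E3.A \<rho>\<^sub>2"
    using f1 g1 by (auto intro: dv_mapI E1.emb.dom.de_vries_algebra_axioms
        E2.emb.dom.de_vries_algebra_axioms E3.emb.dom.de_vries_algebra_axioms)
  interpret m: dv_composite E1.A E2.A E3.A \<rho>\<^sub>1 \<rho>\<^sub>2 using m1 m2 by (rule dv_compositeI)
  have "compose (carrier E1.A) (compose (carrier E1.B) \<sigma>\<^sub>2 \<sigma>\<^sub>1) E1.\<alpha>
      = compose (carrier E1.A) \<sigma>\<^sub>2 (compose (carrier E1.A) \<sigma>\<^sub>1 E1.\<alpha>)"
    by (auto simp: compose_def fun_eq_iff)
  also have "\<dots> = dv_comp E1.A E3.B (compose (carrier E2.A) \<sigma>\<^sub>2 E2.\<alpha>) \<rho>\<^sub>1"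
  proof (rule extensionalityI[of _ "carrier E1.A"])
    fix b assume b: "b \<in> carrier E1.A"
    have sub: "(\<lambda>a. E2.\<alpha> (\<rho>\<^sub>1 a)) ` {a \<in> carrier E1.A. a \<prec>\<^bsub>E1.A\<^esub> b} \<subseteq> carrier E2.B" by auto
    show "compose (carrier E1.A) \<sigma>\<^sub>2 (compose (carrier E1.A) \<sigma>\<^sub>1 E1.\<alpha>) b
      = dv_comp E1.A E3.B (compose (carrier E2.A) \<sigma>\<^sub>2 E2.\<alpha>) \<rho>\<^sub>1 b"
      using b unfolding f3
      by (simp add: compose_eq dv_comp_def complete_boolean_homD(3)[OF g2 sub] image_image
          cong: image_cong_simp)
  qed (simp_all add: compose_def dv_comp_def)
  also have "\<dots> = dv_comp E1.A E3.B E3.\<alpha> (dv_comp E1.A E3.A \<rho>\<^sub>2 \<rho>\<^sub>1)"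
    unfolding g3 by (rule dv_comp_assoc[OF m1 m2 E3.emb.dv_map_axioms])
  finally show ?thesis
    using m.comp_morphism
      compose_complete_boolean_hom[OF f2 g2 E1.emb.cod.complete_boolean_lattice_axioms]
    by (simp add: dv_ext_morphism_iff)
qed

lemma DeVe_simps:
  "Obj DeVe = Collect dv_extension"
  "Hom DeVe = (\<lambda>E E'. Collect (dv_ext_morphism E E'))"
  "Id DeVe = (\<lambda>E. (\<lambda>a\<in>carrier (src E). a, \<lambda>b\<in>carrier (tgt E). b))"
  "Comp DeVe = (\<lambda>E1 E2 E3 g f. (dv_comp (src E1) (src E3) (fst g) (fst f),
     compose (carrier (tgt E1)) (snd g) (snd f)))"
  by (auto simp: DeVe_def dv_extension_def fun_eq_iff)

lemma is_category_DeVe: "is_category (DeVe :: (('a, 'b) dv_ext, ('a \<Rightarrow> 'a) \<times> ('b \<Rightarrow> 'b)) category)"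
  unfolding is_category_def
proof (intro conjI ballI)
  fix E :: "('a, 'b) dv_ext" assume "E \<in> Obj DeVe"
  then interpret dv_extension E by (simp add: DeVe_simps)
  have "compose (carrier A) (\<lambda>b\<in>carrier B. b) \<alpha> = \<alpha>"
    by (rule extensionalityI[OF _ emb.extensional]) (simp_all add: compose_def)
  then show "Id DeVe E \<in> Hom DeVe E E"
    by (simp add: DeVe_simps dv_ext_morphism_iff restrict_id_morphism dv_comp_id emb.dv_map_axioms
        restrict_id_complete_boolean_hom emb.dom.de_vries_algebra_axioms
        emb.cod.complete_boolean_lattice_axioms)
next
  fix X Y Z :: "('a, 'b) dv_ext" and f g
  assume "X \<in> Obj DeVe" "Y \<in> Obj DeVe" "Z \<in> Obj DeVe" "f \<in> Hom DeVe X Y" "g \<in> Hom DeVe Y Z"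
  then show "Comp DeVe X Y Z g f \<in> Hom DeVe X Z"
    using dv_ext_morphism_comp[of X Y Z "fst f" "snd f" "fst g" "snd g"]
    by (simp add: DeVe_simps)
next
  fix X Y :: "('a, 'b) dv_ext" and f
  assume obj: "X \<in> Obj DeVe" "Y \<in> Obj DeVe" and f: "f \<in> Hom DeVe X Y"
  interpret X: dv_extension X using obj by (simp add: DeVe_simps)
  interpret Y: dv_extension Y using obj by (simp add: DeVe_simps)
  have m: "dv_map X.A Y.A (fst f)" and h: "complete_boolean_hom X.B Y.B (snd f)"
    using f X.emb.dom.de_vries_algebra_axioms Y.emb.dom.de_vries_algebra_axioms
    by (auto intro: dv_mapI simp: DeVe_simps dv_ext_morphism_iff)
  note h = complete_boolean_homD[OF h]
  have "compose (carrier X.B) (snd f) (\<lambda>b\<in>carrier X.B. b) = snd f"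
    "compose (carrier X.B) (\<lambda>b\<in>carrier Y.B. b) (snd f) = snd f"
    by (rule extensionalityI[OF _ h(1)]; simp add: compose_def h)+
  then show "Comp DeVe X X Y f (Id DeVe X) = f" "Comp DeVe X Y Y (Id DeVe Y) f = f"
    using dv_comp_id[OF m] by (simp_all add: DeVe_simps prod_eq_iff)
next
  fix W X Y Z :: "('a, 'b) dv_ext" and f g h
  assume obj: "W \<in> Obj DeVe" "X \<in> Obj DeVe" "Y \<in> Obj DeVe" "Z \<in> Obj DeVe"
    and mor: "f \<in> Hom DeVe W X" "g \<in> Hom DeVe X Y" "h \<in> Hom DeVe Y Z"
  interpret W: dv_extension W using obj by (simp add: DeVe_simps)
  interpret X: dv_extension X using obj by (simp add: DeVe_simps)
  interpret Y: dv_extension Y using obj by (simp add: DeVe_simps)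
  interpret Z: dv_extension Z using obj by (simp add: DeVe_simps)
  have "dv_map W.A X.A (fst f)" "dv_map X.A Y.A (fst g)" "dv_map Y.A Z.A (fst h)"
    using mor W.emb.dom.de_vries_algebra_axioms X.emb.dom.de_vries_algebra_axioms
      Y.emb.dom.de_vries_algebra_axioms Z.emb.dom.de_vries_algebra_axioms
    by (auto intro: dv_mapI simp: DeVe_simps dv_ext_morphism_iff)
  moreover have "complete_boolean_hom W.B X.B (snd f)"
    using mor by (simp add: DeVe_simps dv_ext_morphism_iff)
  note complete_boolean_homD(2)[OF this]
  ultimately show "Comp DeVe W X Z (Comp DeVe X Y Z h g) f = Comp DeVe W Y Z h (Comp DeVe W X Y g f)"
    by (simp add: DeVe_simps dv_comp_assoc[where B = X.A and C = Y.A])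
      (auto simp: compose_def)
qed

section \<open>Ends of a de Vries algebra\<close>

text \<open>Ends are the maximal proper round filters. They are defined here by the condition on \<open>\<prec>\<close> that is used
  in computations, which for ultrafilters would read \<open>\<sim> a \<in> F \<or> a \<in> F\<close>. The lemmas \<open>end_maximal\<close> and
  \<open>maximal_is_end\<close> below show that it amounts to maximality.\<close>

definition is_end :: "'a devries \<Rightarrow> 'a set \<Rightarrow> bool" where
  "is_end A F \<longleftrightarrow> round_filter A F \<and> \<bottom>\<^bsub>A\<^esub> \<notin> F \<and>
     (\<forall>a\<in>carrier A. \<forall>b\<in>carrier A. a \<prec>\<^bsub>A\<^esub> b \<longrightarrow> \<sim>\<^bsub>A\<^esub> a \<in> F \<or> b \<in> F)"

text \<open>For round filters \<open>F\<close> and \<open>G\<close>, this is the filter generated by their union.\<close>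

definition filter_sup :: "'a devries \<Rightarrow> 'a set \<Rightarrow> 'a set \<Rightarrow> 'a set" where
  "filter_sup A F G = {z \<in> carrier A. \<exists>f\<in>F. \<exists>g\<in>G. f \<sqinter>\<^bsub>A\<^esub> g \<sqsubseteq>\<^bsub>A\<^esub> z}"

lemma round_filterD:
  assumes "round_filter A F"
  shows "a \<in> F \<Longrightarrow> a \<in> carrier A" "\<exists>a. a \<in> F"
    "\<lbrakk>a \<in> F; b \<in> carrier A; a \<sqsubseteq>\<^bsub>A\<^esub> b\<rbrakk> \<Longrightarrow> b \<in> F"
    "\<lbrakk>a \<in> F; b \<in> F\<rbrakk> \<Longrightarrow> a \<sqinter>\<^bsub>A\<^esub> b \<in> F"
    "b \<in> F \<Longrightarrow> \<exists>a\<in>F. a \<prec>\<^bsub>A\<^esub> b"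
  using assms unfolding round_filter_def lattice_filter_def by blast+

lemma round_idealD:
  assumes "round_ideal A I"
  shows "a \<in> I \<Longrightarrow> a \<in> carrier A" "\<exists>a. a \<in> I"
    "\<lbrakk>a \<in> I; b \<in> carrier A; b \<sqsubseteq>\<^bsub>A\<^esub> a\<rbrakk> \<Longrightarrow> b \<in> I"
    "\<lbrakk>a \<in> I; b \<in> I\<rbrakk> \<Longrightarrow> a \<squnion>\<^bsub>A\<^esub> b \<in> I"
    "a \<in> I \<Longrightarrow> \<exists>b\<in>I. a \<prec>\<^bsub>A\<^esub> b"
  using assms unfolding round_ideal_def lattice_ideal_def by blast+

lemma is_endD:
  assumes "is_end A F"
  shows "round_filter A F" "\<bottom>\<^bsub>A\<^esub> \<notin> F"
    "\<lbrakk>a \<in> carrier A; b \<in> carrier A; a \<prec>\<^bsub>A\<^esub> b\<rbrakk> \<Longrightarrow> \<sim>\<^bsub>A\<^esub> a \<in> F \<or> b \<in> F"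
  using assms unfolding is_end_def by blast+

locale dv_algebra = de_vries_algebra A for A :: "'a devries" (structure)
begin

lemma round_filter_top: "round_filter A F \<Longrightarrow> \<top> \<in> F"
  using round_filterD[of A F] by (meson top_closed top_higher)

lemma round_ideal_bottom: "round_ideal A I \<Longrightarrow> \<bottom> \<in> I"
  using round_idealD[of A I] by (meson bottom_closed bottom_lower)

lemma meet_mono: "\<lbrakk>a \<in> carrier A; b \<in> carrier A; c \<in> carrier A; d \<in> carrier A; a \<sqsubseteq> c; b \<sqsubseteq> d\<rbrakk>
    \<Longrightarrow> a \<sqinter> b \<sqsubseteq> c \<sqinter> d"
  using le_trans[OF meet_left[of a b], of c] le_trans[OF meet_right[of a b], of d]
  by (simp add: le_meet_iff)

lemma round_filter_sup:
  assumes F: "round_filter A F" and G: "round_filter A G"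
  shows "round_filter A (filter_sup A F G)"
proof -
  note [simp] = round_filterD(1)[OF F] round_filterD(1)[OF G]
  have sup: "z \<in> filter_sup A F G \<longleftrightarrow> z \<in> carrier A \<and> (\<exists>f\<in>F. \<exists>g\<in>G. f \<sqinter> g \<sqsubseteq> z)" for z
    by (simp add: filter_sup_def)
  show ?thesis unfolding round_filter_def lattice_filter_def
  proof (intro conjI ballI impI)
    show "filter_sup A F G \<subseteq> carrier A" by (auto simp: sup)
    show "filter_sup A F G \<noteq> {}"
      using round_filterD(2)[OF F] round_filterD(2)[OF G] by (force simp: filter_sup_def)
  next
    fix a b assume "a \<in> filter_sup A F G" "b \<in> carrier A" "a \<sqsubseteq> b"
    then show "b \<in> filter_sup A F G"
      unfolding sup by (meson le_trans meet_closed round_filterD(1)[OF F] round_filterD(1)[OF G])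
  next
    fix a b assume "a \<in> filter_sup A F G" "b \<in> filter_sup A F G"
    then obtain f g f' g' where [simp]: "a \<in> carrier A" "b \<in> carrier A" "f \<in> F" "g \<in> G" "f' \<in> F" "g' \<in> G"
      and le: "f \<sqinter> g \<sqsubseteq> a" "f' \<sqinter> g' \<sqsubseteq> b" by (auto simp: sup)
    have "(f \<sqinter> f') \<sqinter> (g \<sqinter> g') \<sqsubseteq> a"
      by (rule le_trans[OF meet_mono le(1)]) (simp_all add: meet_left)
    moreover have "(f \<sqinter> f') \<sqinter> (g \<sqinter> g') \<sqsubseteq> b"
      by (rule le_trans[OF meet_mono le(2)]) (simp_all add: meet_right)
    ultimately show "a \<sqinter> b \<in> filter_sup A F G"
      unfolding sup using round_filterD(4)[OF F, of f f'] round_filterD(4)[OF G, of g g']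
      by (intro conjI bexI[of _ "f \<sqinter> f'"] bexI[of _ "g \<sqinter> g'"]) (simp_all add: le_meet_iff)
  next
    fix b assume "b \<in> filter_sup A F G"
    then obtain f g where [simp]: "b \<in> carrier A" "f \<in> F" "g \<in> G" and le: "f \<sqinter> g \<sqsubseteq> b"
      by (auto simp: sup)
    obtain f' where [simp]: "f' \<in> F" and f': "f' \<prec> f" using round_filterD(5)[OF F] by force
    obtain g' where [simp]: "g' \<in> G" and g': "g' \<prec> g" using round_filterD(5)[OF G] by force
    have "f' \<sqinter> g' \<prec> b"
      using prox_le_trans[OF _ _ _ meet_prox_meet[OF _ _ _ _ f' g'] le] by simp
    moreover have "f' \<sqinter> g' \<in> filter_sup A F G" unfolding sup by force
    ultimately show "\<exists>a\<in>filter_sup A F G. a \<prec> b" by blast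
  qed
qed

lemma filter_sup_upper:
  assumes F: "round_filter A F" and G: "round_filter A G"
  shows "F \<subseteq> filter_sup A F G" "G \<subseteq> filter_sup A F G"
proof -
  have "f \<sqinter> \<top> \<sqsubseteq> f" "\<top> \<sqinter> g \<sqsubseteq> g" "f \<in> carrier A" "g \<in> carrier A" if "f \<in> F" "g \<in> G" for f g
    using that round_filterD(1)[OF F] round_filterD(1)[OF G] by (auto intro: meet_left meet_right)
  then show "F \<subseteq> filter_sup A F G" "G \<subseteq> filter_sup A F G"
    unfolding filter_sup_def using round_filter_top[OF F] round_filter_top[OF G] by blast+
qed

lemma round_filter_prox_above:
  assumes [simp]: "a \<in> carrier A"
  shows "round_filter A {d \<in> carrier A. a \<prec> d}"
  unfolding round_filter_def lattice_filter_def
  using DV6[of a] prox_top[of a] by (auto intro: prox_le_trans DV4)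

lemma round_ideal_prox_below:
  assumes [simp]: "b \<in> carrier A"
  shows "round_ideal A {d \<in> carrier A. d \<prec> b}"
  unfolding round_ideal_def lattice_ideal_def
proof (intro conjI ballI impI)
  show "{d \<in> carrier A. d \<prec> b} \<noteq> {}" using bottom_prox[of b] by auto
next
  fix c d assume "c \<in> {d \<in> carrier A. d \<prec> b}" "d \<in> {d \<in> carrier A. d \<prec> b}"
  then have [simp]: "c \<in> carrier A" "d \<in> carrier A" and "c \<prec> b" "d \<prec> b" by auto
  then have "\<sim> b \<prec> \<sim> (c \<squnion> d)" by (simp add: complement_join DV4 DV5)
  then have "c \<squnion> d \<prec> b" using DV5[of "\<sim> b" "\<sim> (c \<squnion> d)"] by simp
  then show "c \<squnion> d \<in> {d \<in> carrier A. d \<prec> b}" by simp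
qed (use DV6[of _ b] in \<open>auto intro: le_prox_trans\<close>)

text \<open>Complementation reverses \<open>\<prec>\<close>, so it exchanges round ideals and round filters. This reduces the
  separation of a filter from an ideal to the extension of a filter.\<close>

lemma round_filter_complements:
  assumes I: "round_ideal A I"
  shows "round_filter A {d \<in> carrier A. \<sim> d \<in> I}"
  unfolding round_filter_def lattice_filter_def
proof (intro conjI ballI impI)
  show "{d \<in> carrier A. \<sim> d \<in> I} \<noteq> {}"
    using round_ideal_bottom[OF I] complement_top top_closed by force
next
  fix a b assume "a \<in> {d \<in> carrier A. \<sim> d \<in> I}" "b \<in> carrier A" "a \<sqsubseteq> b"
  then show "b \<in> {d \<in> carrier A. \<sim> d \<in> I}"
    using round_idealD(3)[OF I, of "\<sim> a" "\<sim> b"] by (simp add: complement_le_iff)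
next
  fix a b assume "a \<in> {d \<in> carrier A. \<sim> d \<in> I}" "b \<in> {d \<in> carrier A. \<sim> d \<in> I}"
  then show "a \<sqinter> b \<in> {d \<in> carrier A. \<sim> d \<in> I}"
    using round_idealD(4)[OF I, of "\<sim> a" "\<sim> b"] complement_complement[of "\<sim> a \<squnion> \<sim> b"]
    by (simp add: complement_join)
next
  fix b assume "b \<in> {d \<in> carrier A. \<sim> d \<in> I}"
  then obtain c where b: "b \<in> carrier A" and c: "c \<in> I" "\<sim> b \<prec> c" 
    using round_idealD(5)[OF I] by blast
  then have "\<sim> c \<prec> b" using DV5[of "\<sim> b" c] round_idealD(1)[OF I] by simp
  then show "\<exists>a\<in>{d \<in> carrier A. \<sim> d \<in> I}. a \<prec> b"
    using c round_idealD(1)[OF I] by (intro bexI[of _ "\<sim> c"]) auto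
qed auto

lemma end_maximal:
  assumes F: "is_end A F" and G: "round_filter A G" "\<bottom> \<notin> G" and sub: "F \<subseteq> G"
  shows "F = G"
proof
  show "G \<subseteq> F"
  proof
    fix b assume b: "b \<in> G"
    then obtain a where a: "a \<in> G" "a \<prec> b" using round_filterD(5)[OF G(1)] by blast
    then have "a \<in> carrier A" "b \<in> carrier A" using b round_filterD(1)[OF G(1)] by auto
    then have "\<sim> a \<in> F \<or> b \<in> F" using is_endD(3)[OF F] a by blast
    moreover have False if "\<sim> a \<in> F"
      using round_filterD(4)[OF G(1) a(1), of "\<sim> a"] that sub G(2) \<open>a \<in> carrier A\<close>
      by (auto simp: meet_complement)
    ultimately show "b \<in> F" by blast
  qed
qed (rule sub)

text \<open>If \<open>a \<prec> b\<close>, then adjoining the round filter of all \<open>d\<close> with \<open>a \<prec> d\<close> either gives nothing new, so that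
  \<open>b \<in> F\<close>, or it yields \<open>f \<sqinter> d = \<bottom>\<close> with \<open>f \<in> F\<close> and \<open>a \<prec> d\<close>, so that \<open>f \<sqsubseteq> \<sim> d \<sqsubseteq> \<sim> a\<close>.\<close>

lemma maximal_is_end:
  assumes F: "round_filter A F" "\<bottom> \<notin> F"
    and max: "\<And>G. \<lbrakk>round_filter A G; \<bottom> \<notin> G; F \<subseteq> G\<rbrakk> \<Longrightarrow> G = F"
  shows "is_end A F"
  unfolding is_end_def
proof (intro conjI ballI impI F)
  fix a b assume [simp]: "a \<in> carrier A" "b \<in> carrier A" and ab: "a \<prec> b"
  let ?U = "{d \<in> carrier A. a \<prec> d}"
  note U = round_filter_prox_above[OF \<open>a \<in> carrier A\<close>]
  note [simp] = round_filterD(1)[OF F(1)]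
  show "\<sim> a \<in> F \<or> b \<in> F"
  proof (cases "\<bottom> \<in> filter_sup A F ?U")
    case True
    then obtain f d where [simp]: "f \<in> F" "d \<in> carrier A" and d: "a \<prec> d" "f \<sqinter> d \<sqsubseteq> \<bottom>"
      unfolding filter_sup_def by blast
    have f: "f \<in> carrier A" "f \<in> F" by simp_all
    have "f \<sqsubseteq> \<sim> d" using d f by (simp add: le_bottom_iff meet_eq_bottom_iff)
    moreover have "\<sim> d \<sqsubseteq> \<sim> a" using DV2[of a d] d by (simp add: complement_le_iff)
    ultimately have "f \<sqsubseteq> \<sim> a" by (rule le_trans) (simp_all add: f)
    then show ?thesis using round_filterD(3)[OF F(1) f(2)] by simp
  next
    case False
    then have "filter_sup A F ?U = F"
      by (intro max round_filter_sup F U filter_sup_upper)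
    moreover have "b \<in> ?U" using ab by simp
    ultimately show ?thesis using filter_sup_upper(2)[OF F(1) U] by blast
  qed
qed

lemma round_filter_chain_Union:
  assumes chain: "subset.chain {F. round_filter A F} C" and ne: "C \<noteq> {}"
  shows "round_filter A (\<Union>C)"
proof -
  have C: "round_filter A F" if "F \<in> C" for F using chain that by (auto simp: subset.chain_def)
  have lin: "F \<subseteq> G \<or> G \<subseteq> F" if "F \<in> C" "G \<in> C" for F G
    using chain that by (auto simp: subset_chain_def)
  show ?thesis unfolding round_filter_def lattice_filter_def
  proof (intro conjI ballI impI)
    show "\<Union>C \<subseteq> carrier A" using round_filterD(1)[OF C] by blast
    show "\<Union>C \<noteq> {}" using ne round_filter_top[OF C] by blast
    show "b \<in> \<Union>C" if "a \<in> \<Union>C" "b \<in> carrier A" "a \<sqsubseteq> b" for a b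
      using that round_filterD(3)[OF C] by blast
    show "\<exists>a\<in>\<Union>C. a \<prec> b" if "b \<in> \<Union>C" for b using that round_filterD(5)[OF C] by blast
    show "a \<sqinter> b \<in> \<Union>C" if ab: "a \<in> \<Union>C" "b \<in> \<Union>C" for a b
    proof -
      from ab obtain F G where FG: "F \<in> C" "a \<in> F" "G \<in> C" "b \<in> G" by blast
      then obtain H where "H \<in> C" "a \<in> H" "b \<in> H" using lin[of F G] by blast
      then show ?thesis using round_filterD(4)[OF C] by blast
    qed
  qed
qed

lemma end_extension:
  assumes F: "round_filter A F" "\<bottom> \<notin> F"
  obtains G where "is_end A G" "F \<subseteq> G"
proof -
  define P where "P = {G. round_filter A G \<and> \<bottom> \<notin> G \<and> F \<subseteq> G}"
  have "\<exists>M\<in>P. \<forall>X\<in>P. M \<subseteq> X \<longrightarrow> X = M"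
  proof (rule subset_Zorn_nonempty)
    show "P \<noteq> {}" using F by (auto simp: P_def)
    fix C assume ne: "C \<noteq> {}" and chain: "subset.chain P C"
    then have "subset.chain {F. round_filter A F} C" by (auto simp: subset_chain_def P_def)
    then show "\<Union>C \<in> P"
      using round_filter_chain_Union[OF _ ne] chain ne by (auto simp: P_def subset_chain_def)
  qed
  then obtain M where "M \<in> P" and max: "\<And>X. X \<in> P \<Longrightarrow> M \<subseteq> X \<Longrightarrow> X = M" by blast
  then have M: "round_filter A M" "\<bottom> \<notin> M" "F \<subseteq> M" by (auto simp: P_def)
  have "is_end A M"
    by (rule maximal_is_end[OF M(1,2)], rule max) (use M(3) in \<open>auto simp: P_def\<close>)
  then show thesis using that M(3) by blast
qed

text \<open>The filter generated by \<open>F\<close> and the complements of elements of \<open>I\<close> is proper: \<open>f \<sqinter> \<sim> i = \<bottom>\<close> would mean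
  \<open>f \<sqsubseteq> i\<close>, and then \<open>i\<close> would lie in both \<open>F\<close> and \<open>I\<close>. Any end above it works.\<close>

lemma end_separation:
  assumes F: "round_filter A F" and I: "round_ideal A I" and disj: "F \<inter> I = {}"
  obtains G where "is_end A G" "F \<subseteq> G" "G \<inter> I = {}"
proof -
  note G = round_filter_complements[OF I]
  have "\<bottom> \<notin> filter_sup A F {d \<in> carrier A. \<sim> d \<in> I}"
  proof
    assume "\<bottom> \<in> filter_sup A F {d \<in> carrier A. \<sim> d \<in> I}"
    then obtain f d where fd: "f \<in> F" "d \<in> carrier A" "\<sim> d \<in> I" "f \<sqinter> d \<sqsubseteq> \<bottom>"
      unfolding filter_sup_def by blast
    then have "f \<sqsubseteq> \<sim> d"
      using round_filterD(1)[OF F] by (simp add: le_bottom_iff meet_eq_bottom_iff)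
    then have "\<sim> d \<in> F" using round_filterD(3)[OF F] fd by simp
    then show False using disj fd by blast
  qed
  then obtain H where H: "is_end A H" "filter_sup A F {d \<in> carrier A. \<sim> d \<in> I} \<subseteq> H"
    by (rule end_extension[OF round_filter_sup[OF F G]])
  have "a \<notin> H" if a: "a \<in> I" for a
  proof
    assume "a \<in> H"
    moreover have [simp]: "a \<in> carrier A" using a round_idealD(1)[OF I] by blast
    have "\<sim> a \<in> {d \<in> carrier A. \<sim> d \<in> I}" using a by simp
    then have "\<sim> a \<in> H" using H(2) filter_sup_upper(2)[OF F G] by blast
    ultimately have "a \<sqinter> \<sim> a \<in> H" by (rule round_filterD(4)[OF is_endD(1)[OF H(1)]])
    then show False using is_endD(2)[OF H(1)] by (simp add: meet_complement)
  qed
  then show thesis using that H filter_sup_upper(1)[OF F G] by blast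
qed

text \<open>As \<open>a\<close> is the join of the elements proximal to it, some \<open>c \<prec> a\<close> is not below \<open>b\<close>. Then the round filter
  above \<open>c\<close> is disjoint from the round ideal below \<open>b\<close>. A round filter disjoint from that ideal cannot
  contain \<open>b\<close> itself.\<close>

lemma end_separates_points:
  assumes [simp]: "a \<in> carrier A" "b \<in> carrier A" and nle: "\<not> a \<sqsubseteq> b"
  obtains G where "is_end A G" "a \<in> G" "b \<notin> G"
proof -
  have "\<not> (\<forall>c\<in>carrier A. c \<prec> a \<longrightarrow> c \<sqsubseteq> b)"
  proof
    assume "\<forall>c\<in>carrier A. c \<prec> a \<longrightarrow> c \<sqsubseteq> b"
    then have "\<Squnion>{c \<in> carrier A. c \<prec> a} \<sqsubseteq> b" by (subst sup_le_iff) auto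
    then show False using nle DV7[of a] by simp
  qed
  then obtain c where c: "c \<in> carrier A" "c \<prec> a" "\<not> c \<sqsubseteq> b" by blast
  have "\<not> d \<prec> b" if "d \<in> carrier A" "c \<prec> d" for d
    using c DV2[of c d] DV2[of d b] le_trans[of c d b] that by auto
  then have "{d \<in> carrier A. c \<prec> d} \<inter> {d \<in> carrier A. d \<prec> b} = {}" by blast
  then obtain G where G: "is_end A G" "{d \<in> carrier A. c \<prec> d} \<subseteq> G" "G \<inter> {d \<in> carrier A. d \<prec> b} = {}"
    by (rule end_separation[OF round_filter_prox_above[OF c(1)] round_ideal_prox_below[OF assms(2)]])
  have "b \<notin> G" using G(3) round_filterD(5,1)[OF is_endD(1)[OF G(1)]] by blast
  moreover have "a \<in> G" using G(2) c by auto
  ultimately show thesis using that G(1) by blast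
qed

end

context dv_map
begin

text \<open>The plain preimage of a round filter need not be round, so it is replaced by its round part.\<close>

lemma end_pullback:
  assumes F: "is_end B F"
  shows "is_end A {b \<in> carrier A. \<exists>a\<in>carrier A. a \<prec>\<^bsub>A\<^esub> b \<and> \<rho> a \<in> F}" (is "is_end A ?F")
  unfolding is_end_def round_filter_def lattice_filter_def
proof (intro conjI ballI impI)
  note R = round_filterD[OF is_endD(1)[OF F]]
  interpret B: dv_algebra B ..
  show "?F \<noteq> {}"
    using dom.DV1 B.round_filter_top[OF is_endD(1)[OF F]] map_top dom.top_closed by force
  show "\<bottom>\<^bsub>A\<^esub> \<notin> ?F" using is_endD(2)[OF F] dom.prox_bottomD by force
  show "b \<in> ?F" if "a \<in> ?F" "b \<in> carrier A" "a \<sqsubseteq>\<^bsub>A\<^esub> b" for a b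
    using that by (auto intro: dom.prox_le_trans)
  show "\<exists>a\<in>?F. a \<prec>\<^bsub>A\<^esub> b" if "b \<in> ?F" for b
    using that dom.DV6[of _ b] by blast
  show "a \<sqinter>\<^bsub>A\<^esub> b \<in> ?F" if ab: "a \<in> ?F" "b \<in> ?F" for a b
  proof -
    from ab obtain c d where "c \<in> carrier A" "c \<prec>\<^bsub>A\<^esub> a" "\<rho> c \<in> F" "d \<in> carrier A" "d \<prec>\<^bsub>A\<^esub> b" "\<rho> d \<in> F"
      "a \<in> carrier A" "b \<in> carrier A" by blast
    then show ?thesis
      using R(4)[of "\<rho> c" "\<rho> d"]
      by (auto simp: map_meet dom.meet_prox_meet intro!: bexI[of _ "c \<sqinter>\<^bsub>A\<^esub> d"])
  qed
  fix a b assume [simp]: "a \<in> carrier A" "b \<in> carrier A" and ab: "a \<prec>\<^bsub>A\<^esub> b"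
  obtain d where d [simp]: "d \<in> carrier A" and ad: "a \<prec>\<^bsub>A\<^esub> d" "d \<prec>\<^bsub>A\<^esub> b"
    using dom.DV6[OF _ _ ab] by auto
  obtain c where c [simp]: "c \<in> carrier A" and ac: "a \<prec>\<^bsub>A\<^esub> c" "c \<prec>\<^bsub>A\<^esub> d"
    using dom.DV6[OF _ _ ad(1)] by auto
  \<comment> \<open>With \<open>a \<prec> c \<prec> d \<prec> b\<close>, the end \<open>F\<close> contains \<open>\<rho> (\<sim> c)\<close>, where \<open>\<sim> c \<prec> \<sim> a\<close>, or \<open>\<rho> d\<close>, where \<open>d \<prec> b\<close>.\<close>
  have "\<rho> (\<sim>\<^bsub>A\<^esub> c) \<in> F \<or> \<rho> d \<in> F"
    using is_endD(3)[OF F _ _ map_prox[OF c d ac(2)]] by simp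
  then show "\<sim>\<^bsub>A\<^esub> a \<in> ?F \<or> b \<in> ?F"
    using dom.DV5[OF _ _ ac(1)] ad(2) by (auto intro: bexI[of _ "\<sim>\<^bsub>A\<^esub> c"] bexI[of _ d])
qed auto

end

section \<open>Compact extensions and lifting of morphisms\<close>

context dv_extension
begin

sublocale A: dv_algebra A ..

text \<open>In terms of de Vries duality, \<open>A\<close> is the algebra of regular open sets of a compact Hausdorff space
  whose points are the ends of \<open>A\<close>, and taking traces maps the atoms of \<open>B\<close> to points of that space.\<close>

definition trace :: "'b \<Rightarrow> 'a set" where
  "trace x = {a \<in> carrier A. x \<sqsubseteq>\<^bsub>B\<^esub> \<alpha> a}"

lemma atom_closed: "atom B x \<Longrightarrow> x \<in> carrier B"
  by (simp add: atom_def)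

text \<open>Roundness is the fourth axiom for the morphism \<open>\<alpha>\<close>, as an atom below a join is below one of its members.
  The condition for ends is the third axiom: \<open>\<sim> \<alpha> (\<sim> a) \<sqsubseteq> \<alpha> b\<close>, and the atom lies below \<open>\<alpha> (\<sim> a)\<close> or its
  complement.\<close>

lemma trace_is_end:
  assumes x: "atom B x"
  shows "is_end A (trace x)"
  unfolding is_end_def round_filter_def lattice_filter_def trace_def
proof (intro conjI ballI impI)
  note [simp] = atom_closed[OF x]
  show "{a \<in> carrier A. x \<sqsubseteq>\<^bsub>B\<^esub> \<alpha> a} \<noteq> {}"
    using emb.map_top by (auto intro!: exI[of _ "\<top>\<^bsub>A\<^esub>"])
  show "\<bottom>\<^bsub>A\<^esub> \<notin> {a \<in> carrier A. x \<sqsubseteq>\<^bsub>B\<^esub> \<alpha> a}"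
    using x by (simp add: emb.cod.le_bottom_iff atom_def)
  show "b \<in> {a \<in> carrier A. x \<sqsubseteq>\<^bsub>B\<^esub> \<alpha> a}"
    if "a \<in> {a \<in> carrier A. x \<sqsubseteq>\<^bsub>B\<^esub> \<alpha> a}" "b \<in> carrier A" "a \<sqsubseteq>\<^bsub>A\<^esub> b" for a b
    using that emb.mono[of a b] emb.cod.le_trans[of x "\<alpha> a" "\<alpha> b"] by simp
  show "a \<sqinter>\<^bsub>A\<^esub> b \<in> {a \<in> carrier A. x \<sqsubseteq>\<^bsub>B\<^esub> \<alpha> a}"
    if "a \<in> {a \<in> carrier A. x \<sqsubseteq>\<^bsub>B\<^esub> \<alpha> a}" "b \<in> {a \<in> carrier A. x \<sqsubseteq>\<^bsub>B\<^esub> \<alpha> a}" for a b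
    using that by (simp add: emb.map_meet emb.cod.le_meet_iff)
  show "\<exists>a\<in>{a \<in> carrier A. x \<sqsubseteq>\<^bsub>B\<^esub> \<alpha> a}. a \<prec>\<^bsub>A\<^esub> b" if "b \<in> {a \<in> carrier A. x \<sqsubseteq>\<^bsub>B\<^esub> \<alpha> a}" for b
  proof -
    have "x \<sqsubseteq>\<^bsub>B\<^esub> \<Squnion>\<^bsub>B\<^esub> (\<alpha> ` {a \<in> carrier A. a \<prec>\<^bsub>A\<^esub> b})" using that emb.map_sup[of b] by simp
    then show ?thesis by (subst (asm) emb.cod.atom_le_sup_iff[OF x]) auto
  qed
  fix a b assume ab: "a \<in> carrier A" "b \<in> carrier A" "a \<prec>\<^bsub>A\<^esub> b"
  have "\<sim>\<^bsub>B\<^esub> \<alpha> (\<sim>\<^bsub>A\<^esub> a) \<sqsubseteq>\<^bsub>B\<^esub> \<alpha> b" using emb.cod.DV2[OF _ _ emb.map_prox[OF ab]] ab by simp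
  then have "x \<sqsubseteq>\<^bsub>B\<^esub> \<alpha> (\<sim>\<^bsub>A\<^esub> a) \<or> x \<sqsubseteq>\<^bsub>B\<^esub> \<alpha> b"
    using emb.cod.atom_le_complement_iff[OF x, of "\<alpha> (\<sim>\<^bsub>A\<^esub> a)"] ab
      emb.cod.le_trans[of x "\<sim>\<^bsub>B\<^esub> \<alpha> (\<sim>\<^bsub>A\<^esub> a)" "\<alpha> b"] by auto
  then show "\<sim>\<^bsub>A\<^esub> a \<in> {a \<in> carrier A. x \<sqsubseteq>\<^bsub>B\<^esub> \<alpha> a} \<or> b \<in> {a \<in> carrier A. x \<sqsubseteq>\<^bsub>B\<^esub> \<alpha> a}"
    using ab by simp
qed auto

text \<open>Compactness is applied to an end and the ideal \<open>{\<bottom>}\<close> only: it forces the meet of \<open>\<alpha> ` F\<close> to be nonzero,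
  and any atom below that meet has the end as its trace by maximality. Conversely, an end that separates
  \<open>F\<close> from \<open>I\<close> is the trace of an atom that lies below \<open>\<Sqinter>(\<alpha> ` F)\<close> but not below \<open>\<Squnion>(\<alpha> ` I)\<close>.\<close>

lemma compact_iff:
  "compact_extension E \<longleftrightarrow> (\<forall>F. is_end A F \<longrightarrow> (\<exists>x. atom B x \<and> trace x = F))"
proof
  assume comp: "compact_extension E"
  show "\<forall>F. is_end A F \<longrightarrow> (\<exists>x. atom B x \<and> trace x = F)"
  proof (intro allI impI)
    fix F assume F: "is_end A F"
    note R = round_filterD[OF is_endD(1)[OF F]]
    have sub: "\<alpha> ` F \<subseteq> carrier B" using R(1) by auto
    have "round_ideal A {\<bottom>\<^bsub>A\<^esub>}"
      using emb.dom.bottom_prox[of "\<bottom>\<^bsub>A\<^esub>"] emb.dom.le_iff_meet[of "\<bottom>\<^bsub>A\<^esub>" "\<bottom>\<^bsub>A\<^esub>"]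
      unfolding round_ideal_def lattice_ideal_def by (auto simp: emb.dom.le_bottom_iff)
    then have "\<not> \<Sqinter>\<^bsub>B\<^esub> (\<alpha> ` F) \<sqsubseteq>\<^bsub>B\<^esub> \<Squnion>\<^bsub>B\<^esub> (\<alpha> ` {\<bottom>\<^bsub>A\<^esub>})"
      using comp is_endD(1,2)[OF F] unfolding compact_extension_def by blast
    then have "\<Sqinter>\<^bsub>B\<^esub> (\<alpha> ` F) \<noteq> \<bottom>\<^bsub>B\<^esub>" by auto
    then obtain x where x: "atom B x" "x \<sqsubseteq>\<^bsub>B\<^esub> \<Sqinter>\<^bsub>B\<^esub> (\<alpha> ` F)"
      using atomic sub unfolding atomic_def by (meson emb.cod.inf_closed)
    then have "F \<subseteq> trace x"
      using sub R(1) atom_closed[OF x(1)] by (auto simp: trace_def emb.cod.le_inf_iff)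
    then have "F = trace x"
      using A.end_maximal[OF F] is_endD(1,2)[OF trace_is_end[OF x(1)]] by blast
    then show "\<exists>x. atom B x \<and> trace x = F" using x by blast
  qed
next
  assume ends: "\<forall>F. is_end A F \<longrightarrow> (\<exists>x. atom B x \<and> trace x = F)"
  show "compact_extension E"
    unfolding compact_extension_def
  proof (intro allI impI notI)
    fix F I assume F: "round_filter A F" and I: "round_ideal A I"
      and le: "\<Sqinter>\<^bsub>B\<^esub> (\<alpha> ` F) \<sqsubseteq>\<^bsub>B\<^esub> \<Squnion>\<^bsub>B\<^esub> (\<alpha> ` I)" and disj: "F \<inter> I = {}"
    obtain G where G: "is_end A G" "F \<subseteq> G" "G \<inter> I = {}"
      using A.end_separation[OF F I disj] by blast
    obtain x where x: "atom B x" and tr: "trace x = G" using ends G(1) by blast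
    have sub: "\<alpha> ` F \<subseteq> carrier B" "\<alpha> ` I \<subseteq> carrier B"
      using round_filterD(1)[OF F] round_idealD(1)[OF I] by auto
    have "x \<sqsubseteq>\<^bsub>B\<^esub> \<Sqinter>\<^bsub>B\<^esub> (\<alpha> ` F)"
      using sub G(2) atom_closed[OF x] by (auto simp: emb.cod.le_inf_iff tr[symmetric] trace_def)
    then have "x \<sqsubseteq>\<^bsub>B\<^esub> \<Squnion>\<^bsub>B\<^esub> (\<alpha> ` I)"
      using le sub atom_closed[OF x] emb.cod.inf_closed emb.cod.sup_closed by (meson emb.cod.le_trans)
    then obtain i where "i \<in> I" "x \<sqsubseteq>\<^bsub>B\<^esub> \<alpha> i"
      using emb.cod.atom_le_sup_iff[OF x sub(2)] by auto
    then have "i \<in> G" using round_idealD(1)[OF I] by (auto simp: tr[symmetric] trace_def)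
    then show False using G(3) \<open>i \<in> I\<close> by blast
  qed
qed

end

text \<open>The homomorphism takes the inverse image under \<open>f\<close>: if elements are thought of as sets of atoms, then
  \<open>\<sigma> b\<close> is the set of atoms mapped into \<open>b\<close>.\<close>

lemma complete_boolean_hom_of_atom_map:
  assumes "complete_boolean_lattice B" and "complete_boolean_lattice C" and at: "atomic C"
    and f: "\<And>x. atom C x \<Longrightarrow> atom B (f x)"
  obtains \<sigma> where "complete_boolean_hom B C \<sigma>"
    "\<And>x b. \<lbrakk>atom C x; b \<in> carrier B\<rbrakk> \<Longrightarrow> x \<sqsubseteq>\<^bsub>C\<^esub> \<sigma> b \<longleftrightarrow> f x \<sqsubseteq>\<^bsub>B\<^esub> b"
proof -
  interpret B: complete_boolean_lattice B by fact
  interpret C: complete_boolean_lattice C by fact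
  define \<sigma> where "\<sigma> = (\<lambda>b\<in>carrier B. \<Squnion>\<^bsub>C\<^esub> {x. atom C x \<and> f x \<sqsubseteq>\<^bsub>B\<^esub> b})"
  have sub: "{x. atom C x \<and> f x \<sqsubseteq>\<^bsub>B\<^esub> b} \<subseteq> carrier C" for b by (auto simp: atom_def)
  have closed [simp]: "\<sigma> b \<in> carrier C" if "b \<in> carrier B" for b
    using that sub by (simp add: \<sigma>_def)
  have fc: "f x \<in> carrier B" if "atom C x" for x using f[OF that] by (simp add: atom_def)
  have iff: "x \<sqsubseteq>\<^bsub>C\<^esub> \<sigma> b \<longleftrightarrow> f x \<sqsubseteq>\<^bsub>B\<^esub> b" if "atom C x" "b \<in> carrier B" for x b
  proof -
    have "x \<sqsubseteq>\<^bsub>C\<^esub> x" using that(1) by (simp add: atom_def)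
    then show ?thesis
      using that C.atom_le_atom[OF that(1)] C.atom_le_sup_iff[OF that(1) sub, of b]
      by (auto simp: \<sigma>_def)
  qed
  have "complete_boolean_hom B C \<sigma>"
    unfolding complete_boolean_hom_def
  proof (intro conjI allI impI ballI)
    show "\<sigma> \<in> carrier B \<rightarrow>\<^sub>E carrier C" by (auto simp: \<sigma>_def sub)
  next
    fix S assume S: "S \<subseteq> carrier B"
    then have im: "\<sigma> ` S \<subseteq> carrier C" by auto
    show "\<sigma> (\<Squnion>\<^bsub>B\<^esub> S) = \<Squnion>\<^bsub>C\<^esub> (\<sigma> ` S)"
    proof (rule C.eq_if_same_atoms[OF at])
      fix x assume x: "atom C x"
      show "x \<sqsubseteq>\<^bsub>C\<^esub> \<sigma> (\<Squnion>\<^bsub>B\<^esub> S) \<longleftrightarrow> x \<sqsubseteq>\<^bsub>C\<^esub> \<Squnion>\<^bsub>C\<^esub> (\<sigma> ` S)"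
        unfolding C.atom_le_sup_iff[OF x im] iff[OF x B.sup_closed[OF S]]
          B.atom_le_sup_iff[OF f[OF x] S]
        using S iff[OF x] by blast
    qed (use S im in simp_all)
    show "\<sigma> (\<Sqinter>\<^bsub>B\<^esub> S) = \<Sqinter>\<^bsub>C\<^esub> (\<sigma> ` S)"
    proof (rule C.eq_if_same_atoms[OF at])
      fix x assume x: "atom C x"
      then have xc: "x \<in> carrier C" by (simp add: atom_def)
      show "x \<sqsubseteq>\<^bsub>C\<^esub> \<sigma> (\<Sqinter>\<^bsub>B\<^esub> S) \<longleftrightarrow> x \<sqsubseteq>\<^bsub>C\<^esub> \<Sqinter>\<^bsub>C\<^esub> (\<sigma> ` S)"
        unfolding C.le_inf_iff[OF im xc] iff[OF x B.inf_closed[OF S]] B.le_inf_iff[OF S fc[OF x]]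
        using S iff[OF x] by blast
    qed (use S im in simp_all)
  next
    fix b assume b: "b \<in> carrier B"
    show "\<sigma> (\<sim>\<^bsub>B\<^esub> b) = \<sim>\<^bsub>C\<^esub> \<sigma> b"
      by (rule C.eq_if_same_atoms[OF at])
        (simp_all add: b iff C.atom_le_complement_iff B.atom_le_complement_iff f)
  qed
  then show thesis using that iff by blast
qed

text \<open>For an atom \<open>x\<close> of the target of \<open>E'\<close>, let \<open>f x\<close> be an atom whose trace is the end pulled back from the
  trace of \<open>x\<close> along \<open>\<rho>\<close>. Then \<open>f x \<sqsubseteq> \<alpha> b\<close> iff \<open>x \<sqsubseteq> \<alpha>' (\<rho> a)\<close> for some \<open>a \<prec> b\<close>, that is, iff
  \<open>x \<sqsubseteq> (\<alpha>' \<star> \<rho>) b\<close>. So the homomorphism induced by \<open>f\<close> makes the square commute.\<close>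

lemma morphism_lift:
  assumes "dv_extension E" and "dv_extension E'" and comp: "compact_extension E"
    and "dv_map (src E) (src E') \<rho>"
  shows "\<exists>\<sigma>. dv_ext_morphism E E' (\<rho>, \<sigma>)"
proof -
  interpret E: dv_extension E by fact
  interpret E': dv_extension E' by fact
  interpret \<rho>: dv_map "src E" "src E'" \<rho> by fact
  define pb where "pb x = {b \<in> carrier E.A. \<exists>a\<in>carrier E.A. a \<prec>\<^bsub>E.A\<^esub> b \<and> \<rho> a \<in> E'.trace x}" for x
  define f where "f x = (SOME y. atom E.B y \<and> E.trace y = pb x)" for x
  have "\<exists>y. atom E.B y \<and> E.trace y = pb x" if "atom E'.B x" for x
    using \<rho>.end_pullback[OF E'.trace_is_end[OF that]] comp unfolding E.compact_iff pb_def by blast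
  then have f: "atom E.B (f x)" "E.trace (f x) = pb x" if "atom E'.B x" for x
    using that unfolding f_def by (metis (mono_tags, lifting) someI_ex)+
  obtain \<sigma> where \<sigma>: "complete_boolean_hom E.B E'.B \<sigma>" and
    iff: "\<And>x b. \<lbrakk>atom E'.B x; b \<in> carrier E.B\<rbrakk> \<Longrightarrow> x \<sqsubseteq>\<^bsub>E'.B\<^esub> \<sigma> b \<longleftrightarrow> f x \<sqsubseteq>\<^bsub>E.B\<^esub> b"
    using complete_boolean_hom_of_atom_map[OF E.emb.cod.complete_boolean_lattice_axioms
        E'.emb.cod.complete_boolean_lattice_axioms E'.atomic, of f] f(1) by blast
  have "compose (carrier E.A) \<sigma> E.\<alpha> = dv_comp E.A E'.B E'.\<alpha> \<rho>"
  proof (rule extensionalityI)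
    fix b assume b: "b \<in> carrier E.A"
    have sub: "(\<lambda>a. E'.\<alpha> (\<rho> a)) ` {a \<in> carrier E.A. a \<prec>\<^bsub>E.A\<^esub> b} \<subseteq> carrier E'.B" by auto
    have "\<sigma> (E.\<alpha> b) = \<Squnion>\<^bsub>E'.B\<^esub> ((\<lambda>a. E'.\<alpha> (\<rho> a)) ` {a \<in> carrier E.A. a \<prec>\<^bsub>E.A\<^esub> b})"
    proof (rule E'.emb.cod.eq_if_same_atoms[OF E'.atomic])
      fix x assume x: "atom E'.B x"
      have "x \<sqsubseteq>\<^bsub>E'.B\<^esub> \<sigma> (E.\<alpha> b) \<longleftrightarrow> b \<in> E.trace (f x)"
        using iff[OF x] b by (simp add: E.trace_def)
      also have "\<dots> \<longleftrightarrow> (\<exists>a\<in>carrier E.A. a \<prec>\<^bsub>E.A\<^esub> b \<and> x \<sqsubseteq>\<^bsub>E'.B\<^esub> E'.\<alpha> (\<rho> a))"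
        using b by (auto simp: f(2)[OF x] pb_def E'.trace_def)
      also have "\<dots> \<longleftrightarrow> x \<sqsubseteq>\<^bsub>E'.B\<^esub> \<Squnion>\<^bsub>E'.B\<^esub> ((\<lambda>a. E'.\<alpha> (\<rho> a)) ` {a \<in> carrier E.A. a \<prec>\<^bsub>E.A\<^esub> b})"
        unfolding E'.emb.cod.atom_le_sup_iff[OF x sub] by auto
      finally show "x \<sqsubseteq>\<^bsub>E'.B\<^esub> \<sigma> (E.\<alpha> b) \<longleftrightarrow>
        x \<sqsubseteq>\<^bsub>E'.B\<^esub> \<Squnion>\<^bsub>E'.B\<^esub> ((\<lambda>a. E'.\<alpha> (\<rho> a)) ` {a \<in> carrier E.A. a \<prec>\<^bsub>E.A\<^esub> b})" .
    qed (use b sub complete_boolean_homD(2)[OF \<sigma>] in simp_all)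
    then show "compose (carrier E.A) \<sigma> E.\<alpha> b = dv_comp E.A E'.B E'.\<alpha> \<rho> b"
      using b by (simp add: compose_eq dv_comp_def)
  qed (simp_all add: compose_def dv_comp_def)
  then show ?thesis using \<sigma> \<rho>.morphism by (auto simp: dv_ext_morphism_iff)
qed

section \<open>The extension of a de Vries algebra by its ends\<close>

lemma de_vries_algebraI_le:
  fixes L (structure)
  assumes "complete_boolean_lattice L"
    and prox: "\<And>a b. \<lbrakk>a \<in> carrier L; b \<in> carrier L\<rbrakk> \<Longrightarrow> a \<prec> b \<longleftrightarrow> a \<sqsubseteq> b"
  shows "de_vries_algebra L"
proof -
  interpret complete_boolean_lattice L by fact
  show ?thesis
  proof
    show "\<top> \<prec> \<top>" by (simp add: prox)
    show "a \<prec> d" if "a \<in> carrier L" "b \<in> carrier L" "c \<in> carrier L" "d \<in> carrier L"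
      "a \<sqsubseteq> b" "b \<prec> c" "c \<sqsubseteq> d" for a b c d
      using that by (simp add: prox) (meson le_trans)
    show "b = \<Squnion>{a \<in> carrier L. a \<prec> b}" if "b \<in> carrier L" for b
      using that by (intro sup_eqI[symmetric]) (auto simp: prox)
    show "\<exists>c\<in>carrier L. a \<prec> c \<and> c \<prec> b" if "a \<in> carrier L" "b \<in> carrier L" "a \<prec> b" for a b
      using that by (intro bexI[of _ a]) (simp_all add: prox)
  qed (simp_all add: prox le_meet_iff complement_le_iff)
qed

text \<open>The powerset of \<open>X\<close>, transported along an injection \<open>e\<close> into the type that carries the target algebras.\<close>

definition coded_powerset :: "('p set \<Rightarrow> 'b) \<Rightarrow> 'p set \<Rightarrow> 'b devries" where
  "coded_powerset e X =
     \<lparr>carrier = e ` Pow X, eq = (=), le = (\<lambda>u v. inv e u \<subseteq> inv e v), prox = (\<lambda>u v. inv e u \<subseteq> inv e v)\<rparr>"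

locale powerset_code =
  fixes e :: "'p set \<Rightarrow> 'b" and X :: "'p set"
  assumes inj_e: "inj e"
begin

abbreviation P :: "'b devries" where "P \<equiv> coded_powerset e X"

lemma carrier_P: "carrier P = e ` Pow X"
  and prox_P: "prox P = le P"
  and eq_P: "eq P = (=)"
  by (simp_all add: coded_powerset_def)

lemma le_P [simp]: "e U \<sqsubseteq>\<^bsub>P\<^esub> e V \<longleftrightarrow> U \<subseteq> V"
  using inj_e by (simp add: coded_powerset_def)

lemma e_eq [simp]: "e U = e V \<longleftrightarrow> U = V"
  using inj_e by (simp add: inj_eq)

lemma e_closed [simp]: "e U \<in> carrier P \<longleftrightarrow> U \<subseteq> X"
  by (auto simp: carrier_P)

lemma closedE: 
  assumes "u \<in> carrier P"
  obtains U where "u = e U" "U \<subseteq> X"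
  using assms by (auto simp: carrier_P)

lemma subsetE: 
  assumes "S \<subseteq> carrier P"
  obtains \<U> where "S = e ` \<U>" "\<U> \<subseteq> Pow X"
  using assms by (auto simp: carrier_P subset_image_iff)

lemma complete_lattice_P: "complete_lattice P"
proof -
  interpret partial_order P
    by standard (auto simp: eq_P elim!: closedE)
  show ?thesis
  proof (rule complete_latticeI)
    fix S assume "S \<subseteq> carrier P"
    then obtain \<U> where S: "S = e ` \<U>" and \<U>: "\<U> \<subseteq> Pow X" by (rule subsetE)
    have "least P (e (\<Union>\<U>)) (Upper P S)"
    proof (rule least_UpperI)
      fix u assume u: "u \<in> Upper P S"
      then obtain V where V: "u = e V" by (auto simp: Upper_def carrier_P)
      have "U \<subseteq> V" if "U \<in> \<U>" for U
        using u that \<U> by (subst le_P[symmetric]) (auto simp: Upper_def S V simp del: le_P)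
      then show "e (\<Union>\<U>) \<sqsubseteq>\<^bsub>P\<^esub> u" unfolding V by auto
    qed (use \<U> in \<open>auto simp: S\<close>)
    then show "\<exists>s. least P s (Upper P S)" ..
    have "greatest P (e (X \<inter> \<Inter>\<U>)) (Lower P S)"
    proof (rule greatest_LowerI)
      fix u assume u: "u \<in> Lower P S"
      then obtain V where V: "u = e V" "V \<subseteq> X" by (auto simp: Lower_def carrier_P)
      have "V \<subseteq> U" if "U \<in> \<U>" for U
        using u that \<U> by (subst le_P[symmetric]) (auto simp: Lower_def S V simp del: le_P)
      then show "u \<sqsubseteq>\<^bsub>P\<^esub> e (X \<inter> \<Inter>\<U>)" using V by auto
    qed (use \<U> in \<open>auto simp: S\<close>)
    then show "\<exists>s. greatest P s (Lower P S)" ..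
  qed
qed

sublocale lat: complete_lattice P by (rule complete_lattice_P)

lemma sup_P: "\<U> \<subseteq> Pow X \<Longrightarrow> \<Squnion>\<^bsub>P\<^esub> (e ` \<U>) = e (\<Union>\<U>)"
proof (rule lat.sup_eqI)
  fix u assume u: "u \<in> carrier P" "\<And>x. x \<in> e ` \<U> \<Longrightarrow> x \<sqsubseteq>\<^bsub>P\<^esub> u"
  obtain V where V: "u = e V" using u(1) by (rule closedE)
  have "U \<subseteq> V" if "U \<in> \<U>" for U using u(2)[of "e U"] that by (simp add: V)
  then show "e (\<Union>\<U>) \<sqsubseteq>\<^bsub>P\<^esub> u" unfolding V by auto
qed auto

lemma inf_P: "\<U> \<subseteq> Pow X \<Longrightarrow> \<Sqinter>\<^bsub>P\<^esub> (e ` \<U>) = e (X \<inter> \<Inter>\<U>)"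
proof (rule lat.inf_eqI)
  fix u assume u: "u \<in> carrier P" "\<And>x. x \<in> e ` \<U> \<Longrightarrow> u \<sqsubseteq>\<^bsub>P\<^esub> x"
  obtain V where V: "u = e V" "V \<subseteq> X" using u(1) by (rule closedE)
  have "V \<subseteq> U" if "U \<in> \<U>" for U using u(2)[of "e U"] that by (simp add: V)
  then show "u \<sqsubseteq>\<^bsub>P\<^esub> e (X \<inter> \<Inter>\<U>)" using V by auto
qed auto

lemma join_P: "\<lbrakk>U \<subseteq> X; V \<subseteq> X\<rbrakk> \<Longrightarrow> e U \<squnion>\<^bsub>P\<^esub> e V = e (U \<union> V)"
  using sup_P[of "{U, V}"] by (simp add: join_def)

lemma meet_P: "\<lbrakk>U \<subseteq> X; V \<subseteq> X\<rbrakk> \<Longrightarrow> e U \<sqinter>\<^bsub>P\<^esub> e V = e (U \<inter> V)"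
  using inf_P[of "{U, V}"] by (simp add: meet_def Int_absorb1 le_infI1)

lemma bottom_P: "\<bottom>\<^bsub>P\<^esub> = e {}"
  by (rule closedE[OF lat.bottom_closed]) (use lat.bottom_lower[of "e {}"] in auto)

lemma top_P: "\<top>\<^bsub>P\<^esub> = e X"
  by (rule closedE[OF lat.top_closed]) (use lat.top_higher[of "e X"] in auto)

lemma complete_boolean_lattice_P: "complete_boolean_lattice P"
proof
  fix x assume "x \<in> carrier P"
  then obtain U where "x = e U" "U \<subseteq> X" by (rule closedE)
  then show "\<exists>y\<in>carrier P. x \<sqinter>\<^bsub>P\<^esub> y = \<bottom>\<^bsub>P\<^esub> \<and> x \<squnion>\<^bsub>P\<^esub> y = \<top>\<^bsub>P\<^esub>"
    by (intro bexI[of _ "e (X - U)"]) (auto simp: meet_P join_P bottom_P top_P)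
qed (auto simp: meet_P join_P le_infI1 Int_Un_distrib elim!: closedE)

lemma de_vries_algebra_P: "de_vries_algebra P"
  by (rule de_vries_algebraI_le[OF complete_boolean_lattice_P]) (simp add: prox_P)

sublocale boole: complete_boolean_lattice P by (rule complete_boolean_lattice_P)

lemma complement_P: "U \<subseteq> X \<Longrightarrow> \<sim>\<^bsub>P\<^esub> e U = e (X - U)"
  by (rule boole.complement_eqI) (auto simp: meet_P join_P bottom_P top_P)

lemma atom_P: "p \<in> X \<Longrightarrow> atom P (e {p})"
  unfolding atom_def by (auto simp: bottom_P elim!: closedE)

lemma atomic_P: "atomic P"
  unfolding atomic_def
proof (intro ballI impI)
  fix u assume "u \<in> carrier P" "u \<noteq> \<bottom>\<^bsub>P\<^esub>"
  then obtain U where U: "u = e U" "U \<subseteq> X" "U \<noteq> {}" by (auto simp: bottom_P elim!: closedE)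
  then obtain p where "p \<in> U" by blast
  with U show "\<exists>a. atom P a \<and> a \<sqsubseteq>\<^bsub>P\<^esub> u" by (auto intro!: exI[of _ "e {p}"] atom_P)
qed

end

definition extension_by_ends :: "('a set set \<Rightarrow> 'b) \<Rightarrow> 'a devries \<Rightarrow> ('a, 'b) dv_ext" where
  "extension_by_ends e A =
     \<lparr>src = A, tgt = coded_powerset e {F. is_end A F},
      emb = (\<lambda>a\<in>carrier A. e {F. is_end A F \<and> a \<in> F})\<rparr>"

lemma extension_by_ends_simps [simp]:
  "src (extension_by_ends e A) = A"
  "tgt (extension_by_ends e A) = coded_powerset e {F. is_end A F}"
  "emb (extension_by_ends e A) = (\<lambda>a\<in>carrier A. e {F. is_end A F \<and> a \<in> F})"
  by (simp_all add: extension_by_ends_def)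

text \<open>The map \<open>N\<close> sends \<open>a\<close> to the set of ends containing it. It is an order embedding because ends separate
  points, and the axioms for morphisms translate the defining properties of ends. A set \<open>U\<close> of ends is
  the union of its singletons, and \<open>{F}\<close> is the intersection of all \<open>N a\<close> with \<open>a \<in> F\<close> because ends are
  maximal. The trace of the atom \<open>{F}\<close> is \<open>F\<close>, which gives compactness.\<close>

lemma extension_by_ends:
  fixes e :: "'a set set \<Rightarrow> 'b"
  assumes e: "inj e" and A: "de_vries_algebra A"
  shows "de_vries_extension (extension_by_ends e A)" and "compact_extension (extension_by_ends e A)"
proof -
  interpret A: dv_algebra A using A by (simp add: dv_algebra_def)
  interpret P: powerset_code e "{F. is_end A F}" by unfold_locales (rule e)
  define N where "N a = {F. is_end A F \<and> a \<in> F}" for a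
  have N: "N a \<subseteq> {F. is_end A F}" for a by (auto simp: N_def)
  have N_mono: "N a \<subseteq> N b \<longleftrightarrow> a \<sqsubseteq>\<^bsub>A\<^esub> b" if "a \<in> carrier A" "b \<in> carrier A" for a b
  proof
    show "a \<sqsubseteq>\<^bsub>A\<^esub> b" if "N a \<subseteq> N b"
    proof (rule ccontr)
      assume "\<not> a \<sqsubseteq>\<^bsub>A\<^esub> b"
      then obtain G where "is_end A G" "a \<in> G" "b \<notin> G"
        using A.end_separates_points \<open>a \<in> carrier A\<close> \<open>b \<in> carrier A\<close> by blast
      then show False using that by (auto simp: N_def)
    qed
    show "N a \<subseteq> N b" if "a \<sqsubseteq>\<^bsub>A\<^esub> b"
      using that \<open>b \<in> carrier A\<close> by (auto simp: N_def intro: round_filterD(3)[OF is_endD(1)])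
  qed
  define \<alpha> where "\<alpha> = (\<lambda>a\<in>carrier A. e (N a))"
  have \<alpha>: "\<alpha> a = e (N a)" if "a \<in> carrier A" for a using that by (simp add: \<alpha>_def)
  have emb: "emb (extension_by_ends e A) = \<alpha>" by (simp add: \<alpha>_def N_def)
  have "de_vries_morphism A P.P \<alpha>"
    unfolding de_vries_morphism_def
  proof (intro conjI ballI impI)
    show "\<alpha> \<in> carrier A \<rightarrow>\<^sub>E carrier P.P" using N by (auto simp: \<alpha>_def)
    show "\<alpha> \<bottom>\<^bsub>A\<^esub> = \<bottom>\<^bsub>P.P\<^esub>" by (auto simp: \<alpha> P.bottom_P N_def dest: is_endD(2))
  next
    fix a b assume [simp]: "a \<in> carrier A" "b \<in> carrier A"
    have "a \<sqinter>\<^bsub>A\<^esub> b \<in> F \<longleftrightarrow> a \<in> F \<and> b \<in> F" if "is_end A F" for F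
      using round_filterD(3,4)[OF is_endD(1)[OF that]] A.meet_left[of a b] A.meet_right[of a b]
      by (meson A.meet_closed \<open>a \<in> carrier A\<close> \<open>b \<in> carrier A\<close>)
    then have "N (a \<sqinter>\<^bsub>A\<^esub> b) = N a \<inter> N b" by (auto simp: N_def)
    then show "\<alpha> (a \<sqinter>\<^bsub>A\<^esub> b) = \<alpha> a \<sqinter>\<^bsub>P.P\<^esub> \<alpha> b" by (simp add: \<alpha> P.meet_P N)
  next
    fix a b assume [simp]: "a \<in> carrier A" "b \<in> carrier A" and ab: "a \<prec>\<^bsub>A\<^esub> b"
    have "{F. is_end A F} - N (\<sim>\<^bsub>A\<^esub> a) \<subseteq> N b"
      using is_endD(3)[OF _ _ _ ab] by (auto simp: N_def)
    then show "\<sim>\<^bsub>P.P\<^esub> \<alpha> (\<sim>\<^bsub>A\<^esub> a) \<prec>\<^bsub>P.P\<^esub> \<alpha> b"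
      by (simp add: \<alpha> P.prox_P P.complement_P N)
  next
    fix b assume [simp]: "b \<in> carrier A"
    have "N b = (\<Union>a\<in>{a \<in> carrier A. a \<prec>\<^bsub>A\<^esub> b}. N a)"
    proof
      show "N b \<subseteq> (\<Union>a\<in>{a \<in> carrier A. a \<prec>\<^bsub>A\<^esub> b}. N a)"
      proof
        fix F assume "F \<in> N b"
        then have F: "is_end A F" "b \<in> F" by (auto simp: N_def)
        then obtain a where "a \<in> F" "a \<prec>\<^bsub>A\<^esub> b" using round_filterD(5)[OF is_endD(1)] by meson
        moreover have "a \<in> carrier A" using \<open>a \<in> F\<close> by (rule round_filterD(1)[OF is_endD(1)[OF F(1)]])
        ultimately show "F \<in> (\<Union>a\<in>{a \<in> carrier A. a \<prec>\<^bsub>A\<^esub> b}. N a)" using F(1) by (auto simp: N_def)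
      qed
      show "(\<Union>a\<in>{a \<in> carrier A. a \<prec>\<^bsub>A\<^esub> b}. N a) \<subseteq> N b"
        using A.DV2[of _ b] N_mono[of _ b] by auto
    qed
    moreover have "\<alpha> ` {a \<in> carrier A. a \<prec>\<^bsub>A\<^esub> b} = e ` (N ` {a \<in> carrier A. a \<prec>\<^bsub>A\<^esub> b})"
      unfolding image_image by (rule image_cong) (simp_all add: \<alpha>)
    moreover have "N ` {a \<in> carrier A. a \<prec>\<^bsub>A\<^esub> b} \<subseteq> Pow {F. is_end A F}" using N by auto
    ultimately show "\<alpha> b = \<Squnion>\<^bsub>P.P\<^esub> (\<alpha> ` {a \<in> carrier A. a \<prec>\<^bsub>A\<^esub> b})"
      by (simp add: \<alpha> P.sup_P)
  qed
  moreover have "inj_on \<alpha> (carrier A)"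
    by (rule inj_onI) (metis A.le_antisym A.le_refl N_mono P.e_eq \<alpha>)
  moreover have "\<exists>\<S>\<subseteq>Pow (\<alpha> ` carrier A). u = \<Squnion>\<^bsub>P.P\<^esub> ((\<lambda>S. \<Sqinter>\<^bsub>P.P\<^esub> S) ` \<S>)"
    if u: "u \<in> carrier P.P" for u
  proof -
    obtain U where U: "u = e U" "U \<subseteq> {F. is_end A F}" using u by (rule P.closedE)
    have sub: "F \<subseteq> carrier A" if "is_end A F" for F using round_filterD(1)[OF is_endD(1)[OF that]] by auto
    have meet: "\<Sqinter>\<^bsub>P.P\<^esub> (\<alpha> ` F) = e {F}" if F: "is_end A F" for F
    proof -
      have "\<alpha> ` F = e ` (N ` F)"
        unfolding image_image using sub[OF F] by (intro image_cong) (auto simp: \<alpha>)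
      moreover have "N ` F \<subseteq> Pow {F. is_end A F}" using N by auto
      moreover have "{F. is_end A F} \<inter> \<Inter>(N ` F) = {F}"
      proof -
        have "G = F" if "is_end A G" "F \<subseteq> G" for G
          using A.end_maximal[OF F is_endD(1,2)[OF that(1)] that(2)] by simp
        then show ?thesis using F by (auto simp: N_def)
      qed
      ultimately show ?thesis by (simp add: P.inf_P)
    qed
    have "(\<lambda>S. \<Sqinter>\<^bsub>P.P\<^esub> S) ` ((\<lambda>F. \<alpha> ` F) ` U) = e ` ((\<lambda>F. {F}) ` U)"
      unfolding image_image using U meet by (intro image_cong) auto
    moreover have "\<Squnion>\<^bsub>P.P\<^esub> (e ` ((\<lambda>F. {F}) ` U)) = e U"
      using U(2) by (subst P.sup_P) auto
    moreover have "(\<lambda>F. \<alpha> ` F) ` U \<subseteq> Pow (\<alpha> ` carrier A)" using U(2) sub by blast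
    ultimately show ?thesis using U(1) by metis
  qed
  ultimately show ext: "de_vries_extension (extension_by_ends e A)"
    unfolding de_vries_extension_def emb
    using A P.de_vries_algebra_P P.atomic_P
    by (simp add: extremally_disconnected_def P.prox_P)
  interpret E: dv_extension "extension_by_ends e A" by unfold_locales (rule ext)
  have "E.trace (e {F}) = F" if "is_end A F" for F
    using round_filterD(1)[OF is_endD(1)[OF that]] that unfolding E.trace_def emb
    by (auto simp: \<alpha> N_def)
  then show "compact_extension (extension_by_ends e A)"
    unfolding E.compact_iff using P.atom_P by auto
qed

section \<open>The equivalence\<close>

lemma CDeVe_simps:
  "Obj CDeVe = {E. dv_extension E \<and> compact_extension E}"
  "Hom CDeVe = (\<lambda>E E'. Collect (dv_ext_morphism E E'))"
  "Id CDeVe = Id DeVe"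
  "Comp CDeVe = Comp DeVe"
  by (auto simp: CDeVe_def full_subcategory_simps DeVe_simps)

definition source_functor :: "(('a, 'b) dv_ext, ('a \<Rightarrow> 'a) \<times> ('b \<Rightarrow> 'b), 'a devries, 'a \<Rightarrow> 'a) cfunctor" where
  "source_functor = \<lparr>omap = src, amap = (\<lambda>E E' f. fst f)\<rparr>"

lemma source_functor_fully_faithful:
  assumes E: "dv_extension E" "compact_extension E" and E': "dv_extension E'"
  shows "bij_betw fst (Collect (dv_ext_morphism E E')) (Collect (de_vries_morphism (src E) (src E')))"
proof (rule bij_betw_imageI)
  interpret E: dv_extension E by fact
  interpret E': dv_extension E' by fact
  show "inj_on fst (Collect (dv_ext_morphism E E'))"
    by (intro inj_onI prod_eqI E.hom_eqI) (auto simp: dv_ext_morphism_iff)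
  show "fst ` Collect (dv_ext_morphism E E') = Collect (de_vries_morphism (src E) (src E'))"
  proof
    show "Collect (de_vries_morphism E.A E'.A) \<subseteq> fst ` Collect (dv_ext_morphism E E')"
    proof
      fix \<rho> assume "\<rho> \<in> Collect (de_vries_morphism E.A E'.A)"
      then have "dv_map E.A E'.A \<rho>"
        using E.emb.dom.de_vries_algebra_axioms E'.emb.dom.de_vries_algebra_axioms
        by (auto intro: dv_mapI)
      then obtain \<sigma> where "dv_ext_morphism E E' (\<rho>, \<sigma>)" using morphism_lift E E' by blast
      then show "\<rho> \<in> fst ` Collect (dv_ext_morphism E E')"
        by (intro image_eqI[of _ _ "(\<rho>, \<sigma>)"]) simp_all
    qed
  qed (auto simp: dv_ext_morphism_iff)
qed

theorem theorem5p6: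
  assumes "\<exists>e :: 'a set set \<Rightarrow> 'b. inj e"
  shows "equivalent_categories
           (CDeVe :: (('a, 'b) dv_ext, ('a \<Rightarrow> 'a) \<times> ('b \<Rightarrow> 'b)) category)
           (DeV :: ('a devries, 'a \<Rightarrow> 'a) category)"
proof -
  obtain e :: "'a set set \<Rightarrow> 'b" where e: "inj e" using assms by blast
  interpret fully_faithful_section
    "CDeVe :: (('a, 'b) dv_ext, ('a \<Rightarrow> 'a) \<times> ('b \<Rightarrow> 'b)) category"
    "DeV :: ('a devries, 'a \<Rightarrow> 'a) category" source_functor "extension_by_ends e"
  proof
    show "is_category (CDeVe :: (('a, 'b) dv_ext, ('a \<Rightarrow> 'a) \<times> ('b \<Rightarrow> 'b)) category)"
      unfolding CDeVe_def by (rule is_category_full_subcategory[OF is_category_DeVe])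
    show "is_category (DeV :: ('a devries, 'a \<Rightarrow> 'a) category)" by (rule is_category_DeV)
    show "is_functor (CDeVe :: (('a, 'b) dv_ext, ('a \<Rightarrow> 'a) \<times> ('b \<Rightarrow> 'b)) category) DeV source_functor"
      unfolding is_functor_def
      by (auto simp: CDeVe_simps DeVe_simps DeV_simps source_functor_def dv_ext_morphism_iff
          intro: dv_extension.extension[unfolded de_vries_extension_def, THEN conjunct1])
  next
    fix X Y :: "('a, 'b) dv_ext" assume "X \<in> Obj CDeVe" "Y \<in> Obj CDeVe"
    then show "bij_betw (amap source_functor X Y) (Hom CDeVe X Y)
        (Hom DeV (omap source_functor X) (omap source_functor Y))"
      using source_functor_fully_faithful[of X Y]
      by (simp add: CDeVe_simps DeV_simps source_functor_def)
  next
    fix A :: "'a devries" assume "A \<in> Obj DeV"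
    then show "extension_by_ends e A \<in> Obj CDeVe" "omap source_functor (extension_by_ends e A) = A"
      using extension_by_ends[OF e] by (simp_all add: CDeVe_simps DeV_simps source_functor_def dv_extension_def)
  qed
  show ?thesis by (rule equivalent)
qed

end
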